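(* Let $G$ be a Polish group. (1) If $G$ is not distal, then $G$ is $1$-unbalanced. If moreover $G$ is locally compact, then $G$ is not distal if and only if $G$ is $1$-unbalanced. (2) If $G$ is locally compact, then $G$ is not $2$-unbalanced. (3) Let $\Lambda$ be an infinite countable discrete group and $\alpha<\omega_1$. Then $G$ is $\alpha$-unbalanced if and only if the wreath product $\Lambda\wr G$ is $(\alpha+1)$-unbalanced.
   Context: A topological group $G$ is distal if $1_G\notin\overline{\{ghg^{-1}:g\in G\}}$ for every $h\ne 1_G$. For a Polish group $G$, $E(G)$ is the equivalence relation on $G^\omega$ given by $x\,E(G)\,y$ iff $(x(n)y(n)^{-1})_n$ converges in $G$. Let $c(G)\subseteq G^\omega$ be the group of all convergent sequences in $G$, topologized by the supremum metric $d_u(x,y)=\sup_n d(x(n),y(n))$ for a compatible complete metric $d$ on $G$; it is a Polish group acting continuously on $G^\omega$ by left multiplication $(\gamma x)(n)=\gamma(n)x(n)$. For a Polish group $K$ acting continuously on a Polish space $X$, an open neighborhood $V$ of $1_K$ and $\alpha<\omega_1$, define $\leftrightsquigarrow_V^\alpha$ by induction: $x\leftrightsquigarrow_V^0 y$ iff $y\in\overline{Vx}$ and $x\in\overline{Vy}$; for $\alpha>0$, $x\leftrightsquigarrow_V^\alpha y$ iff for every open $W\ni 1_K$ and every open $U\subseteq X$ containing $x$ or $y$ there are $g^x,g^y\in V$ with $g^xx,g^yy\in U$ and $g^xx\leftrightsquigarrow_W^\beta g^yy$ for all $\beta<\alpha$. A Polish group $G$ is $\alpha$-unbalanced if there are $x,y\in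 G^\omega$ with $x\leftrightsquigarrow_{c(G)}^\alpha y$ (for the left multiplication action of $c(G)$ on $G^\omega$) and $(x,y)\notin E(G)$. For a countable discrete group $\Lambda$ and Polish group $G$, the wreath product $\Lambda\wr G$ is $\Lambda\times G^\Lambda$ with the product topology and multiplication $(\lambda_1,\chi_1)(\lambda_2,\chi_2)=(\lambda_1\lambda_2,\chi)$, $\chi(\lambda)=\chi_1(\lambda)\chi_2(\lambda_1^{-1}\lambda)$. *)

theory Defs
  imports "HOL-Analysis.Analysis" "HOL-Algebra.Group" "HOL-Library.Countable_Set_Type"
begin

section \<open>Countable ordinals\<close>

text \<open>
  The elements of \<open>omega1\<close> are the ordinals below \<open>\<omega>\<^sub>1\<close>: the cardinal successor of \<open>\<omega>\<close> is,
  as a well-order, isomorphic to \<open>\<omega>\<^sub>1\<close>. Up to isomorphism the type is determined by being an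
  uncountable well-order all of whose proper initial segments are countable, see
  \<open>uncountable_omega1\<close> and \<open>countable_lessThan_omega1\<close> below.
\<close>

typedef omega1 = "Field (cardSuc natLeq)"
proof -
  have "Field (cardSuc natLeq) \<noteq> {}"
    using Field_cardSuc_not_empty natLeq_Card_order by blast
  then show ?thesis by blast
qed

lemma Well_order_cardSuc_natLeq: "Well_order (cardSuc natLeq)"
  by (simp add: cardSuc_Card_order natLeq_Card_order card_order_on_well_order_on)

instantiation omega1 :: wellorder
begin

definition less_eq_omega1 :: "omega1 \<Rightarrow> omega1 \<Rightarrow> bool" where
  "a \<le> b \<longleftrightarrow> (Rep_omega1 a, Rep_omega1 b) \<in> cardSuc natLeq"

definition less_omega1 :: "omega1 \<Rightarrow> omega1 \<Rightarrow> bool" where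
  "(a::omega1) < b \<longleftrightarrow> a \<le> b \<and> a \<noteq> b"

instance
proof
  let ?r = "cardSuc natLeq"
  have lin: "Linear_order ?r" and wf: "wf (?r - Id)"
    using Well_order_cardSuc_natLeq by (auto simp: well_order_on_def)
  have "Refl ?r" and tr: "trans ?r" and an: "antisym ?r" and tot: "Total ?r"
    using lin by (auto simp: order_on_defs)
  show refl: "a \<le> a" for a :: omega1
    using \<open>Refl ?r\<close> Rep_omega1[of a] by (auto simp: less_eq_omega1_def refl_on_def)
  show antisym: "a = b" if "a \<le> b" "b \<le> a" for a b :: omega1
    using that an Rep_omega1_inject[of a b] by (auto simp: less_eq_omega1_def dest: antisymD)
  show "(a < b) = (a \<le> b \<and> \<not> b \<le> a)" for a b :: omega1
    using refl antisym by (auto simp: less_omega1_def)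
  show "a \<le> c" if "a \<le> b" "b \<le> c" for a b c :: omega1
    using that tr by (auto simp: less_eq_omega1_def dest: transD)
  show "a \<le> b \<or> b \<le> a" for a b :: omega1
    using tot refl[of a] Rep_omega1[of a] Rep_omega1[of b] Rep_omega1_inject[of a b]
    by (auto simp: less_eq_omega1_def total_on_def)
  have "wf (inv_image (?r - Id) Rep_omega1)"
    using wf by (rule wf_inv_image)
  moreover have "inv_image (?r - Id) Rep_omega1 = {(a, b). a < b}"
    by (auto simp: inv_image_def less_omega1_def less_eq_omega1_def Rep_omega1_inject)
  ultimately have "wf {(a, b). a < (b::omega1)}"
    by simp
  then show "P a" if "\<And>x. (\<And>y. y < x \<Longrightarrow> P y) \<Longrightarrow> P x" for P and a :: omega1
    using that by (induction a rule: wf_induct_rule) blast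
qed

end

lemma countable_lessThan_omega1: "countable {..<a::omega1}"
proof -
  have "(card_of (underS (cardSuc natLeq) (Rep_omega1 a)), cardSuc natLeq) \<in> ordLess"
    by (intro card_of_underS cardSuc_Card_order natLeq_Card_order Rep_omega1)
  then have "countable (underS (cardSuc natLeq) (Rep_omega1 a))"
    by (simp add: countable_card_le_natLeq cardSuc_ordLeq_ordLess natLeq_Card_order card_of_Card_order)
  moreover have "Rep_omega1 ` {..<a} \<subseteq> underS (cardSuc natLeq) (Rep_omega1 a)"
    by (auto simp: underS_def less_omega1_def less_eq_omega1_def Rep_omega1_inject)
  ultimately have "countable (Rep_omega1 ` {..<a})"
    by (rule countable_subset[rotated])
  then show ?thesis
    by (rule countable_image_inj_on) (meson Rep_omega1_inject inj_onI)
qed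

lemma uncountable_omega1: "uncountable (UNIV :: omega1 set)"
proof
  assume "countable (UNIV :: omega1 set)"
  then have "countable (Field (cardSuc natLeq))"
    by (metis countable_image type_definition.Rep_range type_definition_omega1)
  then have "(card_of (Field (cardSuc natLeq)), natLeq) \<in> ordLeq"
    by (simp add: countable_card_le_natLeq)
  then have "(cardSuc natLeq, natLeq) \<in> ordLeq"
    using card_of_Field_ordIso cardSuc_Card_order natLeq_Card_order ordIso_ordLeq_trans
      ordIso_symmetric by blast
  then show False
    using cardSuc_greater[OF natLeq_Card_order] not_ordLess_ordLeq by blast
qed

instantiation omega1 :: zero
begin

definition zero_omega1 :: omega1 where "0 = (LEAST a::omega1. True)"

instance ..

end

definition osuc :: "omega1 \<Rightarrow> omega1" where
  "osuc a = (LEAST b. a < b)"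

lemma zero_le_omega1: "0 \<le> (a::omega1)"
  by (simp add: zero_omega1_def Least_le)

lemma less_osuc: "a < osuc a"
proof -
  have "\<exists>b. a < b"
  proof (rule ccontr)
    assume "\<nexists>b. a < b"
    then have "UNIV = insert a {..<a}" by (auto simp: not_less order.order_iff_strict)
    then show False
      using uncountable_omega1 countable_lessThan_omega1 by (metis countable_insert)
  qed
  then show ?thesis
    unfolding osuc_def by (rule LeastI_ex)
qed

lemma less_osuc_iff: "b < osuc a \<longleftrightarrow> b \<le> a"
  by (metis less_osuc not_less_Least osuc_def leI order_le_less_trans)


section \<open>Polish groups and distality\<close>

locale topological_group = group G for G (structure) +
  fixes T :: "'a topology"
  assumes topspace_eq: "topspace T = carrier G"
    and continuous_mult: "continuous_map (prod_topology T T) T (\<lambda>(x, y). x \<otimes> y)"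
    and continuous_inv: "continuous_map T T (\<lambda>x. inv x)"

locale polish_group = topological_group +
  assumes completely_metrizable: "completely_metrizable_space T"
    and second_countable: "second_countable T"

definition distal :: "('a, 'b) monoid_scheme \<Rightarrow> 'a topology \<Rightarrow> bool" where
  "distal G T \<longleftrightarrow>
     (\<forall>h \<in> carrier G. h \<noteq> \<one>\<^bsub>G\<^esub> \<longrightarrow>
        \<one>\<^bsub>G\<^esub> \<notin> T closure_of {g \<otimes>\<^bsub>G\<^esub> h \<otimes>\<^bsub>G\<^esub> inv\<^bsub>G\<^esub> g | g. g \<in> carrier G})"


section \<open>The group of convergent sequences and the relation \<open>E(G)\<close>\<close>

abbreviation seq_topology :: "'a topology \<Rightarrow> (nat \<Rightarrow> 'a) topology" where
  "seq_topology T \<equiv> product_topology (\<lambda>_. T) UNIV"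

definition conv_seqs :: "'a topology \<Rightarrow> (nat \<Rightarrow> 'a) set" where
  "conv_seqs T = {x \<in> UNIV \<rightarrow> topspace T. \<exists>l. limitin T x l sequentially}"

definition seq_mult :: "('a, 'b) monoid_scheme \<Rightarrow> (nat \<Rightarrow> 'a) \<Rightarrow> (nat \<Rightarrow> 'a) \<Rightarrow> nat \<Rightarrow> 'a" where
  "seq_mult G x y = (\<lambda>n. x n \<otimes>\<^bsub>G\<^esub> y n)"

definition conv_seq_group :: "('a, 'b) monoid_scheme \<Rightarrow> 'a topology \<Rightarrow> (nat \<Rightarrow> 'a) monoid" where
  "conv_seq_group G T =
     \<lparr>carrier = conv_seqs T, monoid.mult = seq_mult G, one = (\<lambda>n. \<one>\<^bsub>G\<^esub>)\<rparr>"

definition complete_metric_for :: "'a topology \<Rightarrow> 'a metric \<Rightarrow> bool" where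
  "complete_metric_for T m \<longleftrightarrow> mtopology_of m = T \<and> mcomplete_of m"

text \<open>
  \<open>funspace UNIV m\<close> is the space of bounded sequences with the supremum metric; convergent sequences
  are bounded, so the restriction to \<open>conv_seqs T\<close> discards nothing.
\<close>

definition sup_metric :: "'a topology \<Rightarrow> 'a metric \<Rightarrow> (nat \<Rightarrow> 'a) metric" where
  "sup_metric T m = submetric (funspace UNIV m) (conv_seqs T)"

text \<open>The choice of the metric is immaterial, see \<open>conv_seq_topology_eq\<close>.\<close>

definition conv_seq_topology :: "'a topology \<Rightarrow> (nat \<Rightarrow> 'a) topology" where
  "conv_seq_topology T = mtopology_of (sup_metric T (SOME m. complete_metric_for T m))"

lemma ex_complete_metric_for:
  assumes "completely_metrizable_space T"
  shows "\<exists>m. complete_metric_for T m"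
proof -
  obtain M d where "Metric_space M d" "Metric_space.mcomplete M d" "T = Metric_space.mtopology M d"
    using assms by (auto simp: completely_metrizable_space_def)
  then have "complete_metric_for T (metric (M, d))"
    by (simp add: complete_metric_for_def mtopology_of_def mcomplete_of_def
        Metric_space.mspace_metric Metric_space.mdist_metric)
  then show ?thesis ..
qed

lemma mspace_sup_metric:
  assumes "mtopology_of m = T"
  shows "mspace (sup_metric T m) = conv_seqs T"
proof -
  interpret Metric_space "mspace m" "mdist m" by simp
  have top: "mtopology = T" using assms by (simp add: mtopology_of_def)
  have "mbounded (range x)" if x: "x \<in> conv_seqs T" for x
  proof -
    from x obtain l where sub: "range x \<subseteq> mspace m" and l: "limitin mtopology x l sequentially"
      unfolding conv_seqs_def top[symmetric] by (auto simp: image_subset_iff)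
    then have "l \<in> mspace m" "\<forall>\<^sub>F n in sequentially. x n \<in> mball l 1"
      by (auto simp: limitin_metric commute)
    then obtain N where N: "\<And>n. n \<ge> N \<Longrightarrow> x n \<in> mball l 1"
      by (auto simp: eventually_sequentially)
    have "mbounded (mball l 1 \<union> x ` {..<N})"
      using sub by (auto simp: mbounded_Un mbounded_mball image_subset_iff
          intro!: compactin_imp_mbounded finite_imp_compactin)
    moreover have "range x \<subseteq> mball l 1 \<union> x ` {..<N}"
      using N by (force simp: not_less[symmetric])
    ultimately show ?thesis by (rule mbounded_subset)
  qed
  moreover have "x \<in> UNIV \<rightarrow>\<^sub>E mspace m" if "x \<in> conv_seqs T" for x
    using that top by (auto simp: conv_seqs_def)
  ultimately show ?thesis
    by (auto simp: sup_metric_def fspace_def)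
qed

lemma mdist_sup_metric:
  assumes "mtopology_of m = T" "x \<in> conv_seqs T" "y \<in> conv_seqs T"
  shows "mdist (sup_metric T m) x y = (SUP n. mdist m (x n) (y n))"
  using assms mspace_sup_metric[OF assms(1)]
  by (auto simp: sup_metric_def Metric_space.fdist_def[OF Metric_space_mspace_mdist])

lemma sup_metric_openin_mono:
  assumes m1: "mtopology_of m1 = T" and m2: "mtopology_of m2 = T"
    and U: "openin (mtopology_of (sup_metric T m2)) U"
  shows "openin (mtopology_of (sup_metric T m1)) U"
proof -
  interpret A: Metric_space "mspace m1" "mdist m1" by simp
  interpret B: Metric_space "mspace m2" "mdist m2" by simp
  interpret SA: Metric_space "conv_seqs T" "mdist (sup_metric T m1)"
    using Metric_space_mspace_mdist[of "sup_metric T m1"] m1 by (simp add: mspace_sup_metric)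
  interpret SB: Metric_space "conv_seqs T" "mdist (sup_metric T m2)"
    using Metric_space_mspace_mdist[of "sup_metric T m2"] m2 by (simp add: mspace_sup_metric)
  have topA: "A.mtopology = T" and topB: "B.mtopology = T"
    using m1 m2 by (simp_all add: mtopology_of_def)
  have sp: "mspace m1 = topspace T" "mspace m2 = topspace T"
    using topA topB by (metis A.topspace_mtopology, metis B.topspace_mtopology)
  have fs: "conv_seqs T \<subseteq> mspace (funspace UNIV m1)" "conv_seqs T \<subseteq> mspace (funspace UNIV m2)"
    using mspace_sup_metric[OF m1] mspace_sup_metric[OF m2] by (auto simp: sup_metric_def)
  have seqA: "mdist m1 (x n) (y n) \<le> mdist (sup_metric T m1) x y"
    if "x \<in> conv_seqs T" "y \<in> conv_seqs T" for x y n
    using that fs(1) funspace_mdist_le[where S=UNIV and f=x and m=m1 and g=y and a="mdist (funspace UNIV m1) x y"]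
    by (auto simp: sup_metric_def)
  have seqB: "mdist (sup_metric T m2) x y \<le> e"
    if "x \<in> conv_seqs T" "y \<in> conv_seqs T" "\<And>n. mdist m2 (x n) (y n) \<le> e" for x y e
    using that fs(2) funspace_mdist_le[where S=UNIV and f=x and m=m2 and g=y and a=e]
    by (auto simp: sup_metric_def)
  have pt: "\<exists>d>0. A.mball p d \<subseteq> B.mball p e" if "p \<in> topspace T" "e > 0" for p e
    using that topA topB sp by (metis A.openin_mtopology B.openin_mball B.centre_in_mball_iff)
  have key: "\<exists>d>0. SA.mball x d \<subseteq> SB.mball x e" if x: "x \<in> conv_seqs T" and e: "e > 0" for x e
  proof -
    from x obtain l where l: "limitin A.mtopology x l sequentially"
      and xT: "\<And>n. x n \<in> topspace T"
      using topA by (auto simp: conv_seqs_def)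
    then have lT: "l \<in> topspace T" using topA by (auto simp: limitin_def)
    obtain d0 where d0: "d0 > 0" "A.mball l d0 \<subseteq> B.mball l (e/4)"
      using pt[OF lT, of "e/4"] e by auto
    have "\<forall>\<^sub>F n in sequentially. x n \<in> A.mball l (d0/2)"
      using l d0 half_gt_zero[OF d0(1)] unfolding A.limitin_metric A.in_mball
      by (simp add: A.commute del: less_divide_eq_numeral1)
    then obtain N where N: "\<And>n. n \<ge> N \<Longrightarrow> x n \<in> A.mball l (d0/2)"
      by (auto simp: eventually_sequentially)
    have "\<forall>n. \<exists>d>0. A.mball (x n) d \<subseteq> B.mball (x n) (e/2)"
      using pt xT e by simp
    then obtain D where D: "\<And>n. D n > 0" "\<And>n. A.mball (x n) (D n) \<subseteq> B.mball (x n) (e/2)"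
      by metis
    define d where "d = Min (insert (d0/2) (D ` {..<N}))"
    have dpos: "d > 0" using d0 D by (auto simp: d_def)
    have d_le: "d \<le> d0/2" "\<And>n. n < N \<Longrightarrow> d \<le> D n"
      unfolding d_def by (rule Min_le; simp)+
    have "y \<in> SB.mball x e" if y: "y \<in> SA.mball x d" for y
    proof -
      have yc: "y \<in> conv_seqs T" and yd: "mdist (sup_metric T m1) x y < d" using y by auto
      have yT: "\<And>n. y n \<in> topspace T" using yc by (auto simp: conv_seqs_def)
      have "mdist m2 (x n) (y n) \<le> e/2" for n
      proof -
        have dn: "mdist m1 (x n) (y n) < d" using seqA[OF x yc, of n] yd by linarith
        show ?thesis
        proof (cases "n < N")
          case True
          then have "y n \<in> A.mball (x n) (D n)"
            using dn d_le(2)[OF True] xT[of n] yT[of n] unfolding A.in_mball unfolding sp by auto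
          then show ?thesis using D(2)[of n] by (auto simp: subset_iff)
        next
          case False
          then have xl: "mdist m1 l (x n) < d0/2" using N[of n] by auto
          have "mdist m1 l (y n) \<le> mdist m1 l (x n) + mdist m1 (x n) (y n)"
            using A.triangle[unfolded sp] lT xT yT by blast
          then have "mdist m1 l (y n) < d0" using xl dn d_le(1) by linarith
          then have "y n \<in> A.mball l d0" "x n \<in> A.mball l d0"
            using xl d0 lT xT[of n] yT[of n] unfolding A.in_mball unfolding sp by auto
          then have "mdist m2 l (y n) < e/4" "mdist m2 l (x n) < e/4"
            using d0(2) by (auto simp: subset_iff)
          moreover have "mdist m2 (x n) (y n) \<le> mdist m2 (x n) l + mdist m2 l (y n)"
            using B.triangle[unfolded sp] lT xT yT by blast
          ultimately show ?thesis by (simp add: B.commute)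
        qed
      qed
      then have "mdist (sup_metric T m2) x y \<le> e/2" by (rule seqB[OF x yc])
      then show ?thesis using x yc e by auto
    qed
    then show ?thesis using dpos by blast
  qed
  have "openin SB.mtopology U"
    using U m2 by (simp add: mtopology_of_def mspace_sup_metric)
  then have "openin SA.mtopology U"
    unfolding SA.openin_mtopology SB.openin_mtopology using key by (meson subset_iff order_trans)
  then show ?thesis
    using m1 by (simp add: mtopology_of_def mspace_sup_metric)
qed

lemma conv_seq_topology_eq:
  assumes "complete_metric_for T m"
  shows "conv_seq_topology T = mtopology_of (sup_metric T m)"
proof -
  have "complete_metric_for T (SOME m. complete_metric_for T m)"
    using assms by (rule someI)
  with assms show ?thesis
    unfolding conv_seq_topology_def topology_eq[of "mtopology_of (sup_metric T _)"]
    by (metis complete_metric_for_def sup_metric_openin_mono)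
qed

definition E_rel :: "('a, 'b) monoid_scheme \<Rightarrow> 'a topology \<Rightarrow> ((nat \<Rightarrow> 'a) \<times> (nat \<Rightarrow> 'a)) set" where
  "E_rel G T = {(x, y). x \<in> UNIV \<rightarrow> carrier G \<and> y \<in> UNIV \<rightarrow> carrier G \<and>
     (\<exists>l. limitin T (\<lambda>n. x n \<otimes>\<^bsub>G\<^esub> inv\<^bsub>G\<^esub> y n) l sequentially)}"


section \<open>The relations \<open>\<leftrightsquigarrow>\<^sub>V\<^sup>\<alpha>\<close>\<close>

text \<open>
  \<open>lrsquig K TK TX act a V x y\<close>: the group \<open>K\<close> with topology \<open>TK\<close> acts by \<open>act\<close> on the space \<open>TX\<close>.
\<close>

function lrsquig :: "('k, 'm) monoid_scheme \<Rightarrow> 'k topology \<Rightarrow> 'x topology \<Rightarrow> ('k \<Rightarrow> 'x \<Rightarrow> 'x) \<Rightarrow>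
    omega1 \<Rightarrow> 'k set \<Rightarrow> 'x \<Rightarrow> 'x \<Rightarrow> bool" where
  "lrsquig K TK TX act a V x y \<longleftrightarrow>
     (if a = 0
      then y \<in> TX closure_of ((\<lambda>g. act g x) ` V) \<and> x \<in> TX closure_of ((\<lambda>g. act g y) ` V)
      else (\<forall>W U. openin TK W \<and> \<one>\<^bsub>K\<^esub> \<in> W \<and> openin TX U \<and> (x \<in> U \<or> y \<in> U) \<longrightarrow>
              (\<exists>gx \<in> V. \<exists>gy \<in> V. act gx x \<in> U \<and> act gy y \<in> U \<and>
                 (\<forall>b. b < a \<longrightarrow> lrsquig K TK TX act b W (act gx x) (act gy y)))))"
  by pat_completeness auto
termination
  by (relation "inv_image {(b, a). b < a} (\<lambda>(K, TK, TX, act, a, V, x, y). a)")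
     (auto intro: wf_inv_image wf)

declare lrsquig.simps [simp del]

definition unbalanced :: "omega1 \<Rightarrow> ('a, 'b) monoid_scheme \<Rightarrow> 'a topology \<Rightarrow> bool" where
  "unbalanced a G T \<longleftrightarrow>
     (\<exists>x \<in> UNIV \<rightarrow> carrier G. \<exists>y \<in> UNIV \<rightarrow> carrier G.
        lrsquig (conv_seq_group G T) (conv_seq_topology T) (seq_topology T) (seq_mult G)
          a (carrier (conv_seq_group G T)) x y \<and>
        (x, y) \<notin> E_rel G T)"


section \<open>Wreath products\<close>

definition wreath :: "('l, 'm) monoid_scheme \<Rightarrow> ('a, 'b) monoid_scheme \<Rightarrow> ('l \<times> ('l \<Rightarrow> 'a)) monoid" where
  "wreath L G =
     \<lparr>carrier = carrier L \<times> (carrier L \<rightarrow>\<^sub>E carrier G),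
      monoid.mult = (\<lambda>(l1, c1) (l2, c2).
        (l1 \<otimes>\<^bsub>L\<^esub> l2, \<lambda>l \<in> carrier L. c1 l \<otimes>\<^bsub>G\<^esub> c2 (inv\<^bsub>L\<^esub> l1 \<otimes>\<^bsub>L\<^esub> l))),
      one = (\<one>\<^bsub>L\<^esub>, \<lambda>l \<in> carrier L. \<one>\<^bsub>G\<^esub>)\<rparr>"

definition wreath_topology ::
    "('l, 'm) monoid_scheme \<Rightarrow> 'a topology \<Rightarrow> ('l \<times> ('l \<Rightarrow> 'a)) topology" where
  "wreath_topology L T =
     prod_topology (discrete_topology (carrier L)) (product_topology (\<lambda>_. T) (carrier L))"

end

theory Submission
  imports Defs
begin

text \<open>
  Being related at level 1 by \<open>c(G)\<close> means that for every neighbourhood \<open>W\<close> of the identity some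
  \<open>\<gamma>, \<delta> \<in> c(G)\<close> push \<open>\<gamma> x (\<delta> y)\<inverse>\<close> into \<open>W\<close>. If \<open>a\<close> and \<open>b\<close> are cluster points of \<open>x y\<inverse>\<close> and
  \<open>\<gamma> \<rightarrow> p\<close>, then \<open>p a b\<inverse> p\<inverse>\<close> is close to the identity, so \<open>a b\<inverse>\<close> witnesses non-distality; conversely,
  a witness \<open>h\<close> of non-distality yields the constant sequence \<open>1\<close> and the sequence alternating
  between \<open>1\<close> and \<open>h\<close>. In a locally compact group a nonconvergent \<open>x y\<inverse>\<close> has, after moving \<open>x\<close> and \<open>y\<close>
  by \<open>c(G)\<close>, two distinct cluster points. At level 2 the conjugators \<open>p\<close> moreover stay in a fixed
  compact set, which forces \<open>a = b\<close>.

  For the wreath product, both directions transfer the relations along equivariant maps: coordinate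
  projections, and the embedding of \<open>G\<close> at one coordinate \<open>\<lambda>\<close>. A neighbourhood of the identity of the
  wreath product restricts only finitely many coordinates, so after a translation moving the
  interesting coordinate off that finite set it acts there as all of \<open>c(G)\<close>.
\<close>

section \<open>The relations \<open>\<leftrightsquigarrow>\<^sub>V\<^sup>\<alpha>\<close> under equivariant maps\<close>

lemma lrsquig_zero:
  "lrsquig K TK TX act 0 V x y \<longleftrightarrow>
     y \<in> TX closure_of ((\<lambda>g. act g x) ` V) \<and> x \<in> TX closure_of ((\<lambda>g. act g y) ` V)"
  by (subst lrsquig.simps) simp

lemma lrsquig_pos:
  assumes "a \<noteq> 0"
  shows "lrsquig K TK TX act a V x y \<longleftrightarrow>
     (\<forall>W U. openin TK W \<and> \<one>\<^bsub>K\<^esub> \<in> W \<and> openin TX U \<and> (x \<in> U \<or> y \<in> U) \<longrightarrow>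
        (\<exists>gx \<in> V. \<exists>gy \<in> V. act gx x \<in> U \<and> act gy y \<in> U \<and>
           (\<forall>b < a. lrsquig K TK TX act b W (act gx x) (act gy y))))"
  using assms by (subst lrsquig.simps) simp

lemma osuc_neq_0: "osuc a \<noteq> 0"
  using less_osuc[of a] zero_le_omega1[of a] by auto

text \<open>As \<open>b < osuc a\<close> means \<open>b \<le> a\<close>, one pair of moves serves
  level 0 and level \<open>a\<close> at once: level 0 will bound quotients, level \<open>a\<close>
  carries the argument on.\<close>

lemma lrsquig_osucD:
  assumes "lrsquig K TK TX act (osuc a) V x y"
    and "openin TK W" "\<one>\<^bsub>K\<^esub> \<in> W" "openin TX U" "x \<in> U \<or> y \<in> U"
  obtains gx gy where "gx \<in> V" "gy \<in> V" "act gx x \<in> U" "act gy y \<in> U"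
    "\<forall>b\<le>a. lrsquig K TK TX act b W (act gx x) (act gy y)"
  using assms unfolding lrsquig_pos[OF osuc_neq_0] less_osuc_iff by blast

text \<open>Positive levels pass down because the condition at \<open>a\<close> already quantifies
  over all smaller levels. Level 0 is its reachability clause alone: \<open>gx\<close> carries
  \<open>x\<close> into a given neighbourhood of \<open>y\<close>, and \<open>gy\<close> carries
  \<open>y\<close> into one of \<open>x\<close>. The set \<open>W0\<close> is what \<open>W\<close>
  is instantiated with.\<close>

lemma lrsquig_antimono:
  assumes "lrsquig K TK TX act a V x y" "b \<le> a" "x \<in> topspace TX" "y \<in> topspace TX"
    and "openin TK W0" "\<one>\<^bsub>K\<^esub> \<in> W0"
  shows "lrsquig K TK TX act b V x y"
proof (cases "b = a")
  case False
  with assms(2) zero_le_omega1[of b] have "a \<noteq> 0" and "b < a" by auto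
  note a = assms(1)[unfolded lrsquig_pos[OF \<open>a \<noteq> 0\<close>], rule_format]
  show ?thesis
  proof (cases "b = 0")
    case True
    show ?thesis
      unfolding True lrsquig_zero in_closure_of
      using assms(3-6) a[of W0] by (simp add: Bex_def) blast
  next
    case False
    show ?thesis
      unfolding lrsquig_pos[OF False]
    proof (intro allI impI)
      fix W U
      assume "openin TK W \<and> \<one>\<^bsub>K\<^esub> \<in> W \<and> openin TX U \<and> (x \<in> U \<or> y \<in> U)"
      from a[OF this] show "\<exists>gx\<in>V. \<exists>gy\<in>V. act gx x \<in> U \<and> act gy y \<in> U \<and>
          (\<forall>c<b. lrsquig K TK TX act c W (act gx x) (act gy y))"
        using \<open>b < a\<close> by (meson order.strict_trans)
    qed
  qed
qed (use assms in simp)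

text \<open>The transfer principle behind both directions for wreath products. Equivariance is asked
  on \<open>B\<close>, since a coordinate projection respects products where the left factor has
  trivial \<Lambda>-component. The assumption \<open>nbhd\<close> expresses continuity of
  \<open>\<Psi>\<close> at the identity and keeps the sets of the next level inside
  \<open>B\<close>. The induction leaves \<open>V\<close> and \<open>V'\<close> free because each
  level replaces them.\<close>

lemma lrsquig_equivariant:
  assumes cont: "continuous_map TX TX' \<Phi>"
    and act: "\<And>g z. g \<in> B \<Longrightarrow> z \<in> topspace TX \<Longrightarrow> act g z \<in> topspace TX"
    and equi: "\<And>g z. g \<in> B \<Longrightarrow> z \<in> topspace TX \<Longrightarrow> \<Phi> (act g z) = act' (\<Psi> g) (\<Phi> z)"
    and nbhd: "\<And>W'. openin TK' W' \<Longrightarrow> \<one>\<^bsub>K'\<^esub> \<in> W' \<Longrightarrow>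
                 \<exists>W. openin TK W \<and> \<one>\<^bsub>K\<^esub> \<in> W \<and> W \<subseteq> B \<and> \<Psi> ` W \<subseteq> W'"
  shows "\<lbrakk>lrsquig K TK TX act a V x y; x \<in> topspace TX; y \<in> topspace TX; V \<subseteq> B; \<Psi> ` V \<subseteq> V'\<rbrakk>
     \<Longrightarrow> lrsquig K' TK' TX' act' a V' (\<Phi> x) (\<Phi> y)"
proof (induction a arbitrary: V V' x y rule: less_induct)
  case (less a)
  show ?case
  proof (cases "a = 0")
    case True
    have "\<Phi> v \<in> TX' closure_of ((\<lambda>g. act' g (\<Phi> u)) ` V')"
      if "v \<in> TX closure_of ((\<lambda>g. act g u) ` V)" "u \<in> topspace TX" for u v
    proof -
      have "\<Phi> v \<in> TX' closure_of (\<Phi> ` (\<lambda>g. act g u) ` V)"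
        using continuous_map_image_closure_subset[OF cont] that by blast
      moreover have "\<Phi> ` (\<lambda>g. act g u) ` V \<subseteq> (\<lambda>g. act' g (\<Phi> u)) ` V'"
        using equi that(2) less.prems(4,5) by (auto simp: image_subset_iff subset_iff)
      ultimately show ?thesis
        using closure_of_mono by blast
    qed
    with less.prems show ?thesis
      by (simp add: True lrsquig_zero)
  next
    case False
    show ?thesis
      unfolding lrsquig_pos[OF False]
    proof (intro allI impI)
      fix W' U'
      assume asm: "openin TK' W' \<and> \<one>\<^bsub>K'\<^esub> \<in> W' \<and> openin TX' U' \<and> (\<Phi> x \<in> U' \<or> \<Phi> y \<in> U')"
      then obtain W where W: "openin TK W" "\<one>\<^bsub>K\<^esub> \<in> W" "W \<subseteq> B" "\<Psi> ` W \<subseteq> W'"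
        using nbhd by blast
      define U where "U = {z \<in> topspace TX. \<Phi> z \<in> U'}"
      have "openin TX U"
        using asm cont by (auto simp: U_def openin_continuous_map_preimage)
      moreover have "x \<in> U \<or> y \<in> U"
        using asm less.prems by (auto simp: U_def)
      ultimately obtain gx gy where g: "gx \<in> V" "gy \<in> V" "act gx x \<in> U" "act gy y \<in> U"
        "\<And>b. b < a \<Longrightarrow> lrsquig K TK TX act b W (act gx x) (act gy y)"
        using less.prems(1) W(1,2) unfolding lrsquig_pos[OF False] by metis
      have g0: "gx \<in> B" "gy \<in> B" "\<Psi> gx \<in> V'" "\<Psi> gy \<in> V'"
        using g(1,2) less.prems(4,5) by auto
      have "lrsquig K' TK' TX' act' b W' (act' (\<Psi> gx) (\<Phi> x)) (act' (\<Psi> gy) (\<Phi> y))" if "b < a" for b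
        using less.IH[OF that g(5)[OF that] _ _ W(3,4)] act equi g0 less.prems(2,3) by simp
      moreover have "act' (\<Psi> gx) (\<Phi> x) \<in> U'" "act' (\<Psi> gy) (\<Phi> y) \<in> U'"
        using g(3,4) equi[OF g0(1) less.prems(2)] equi[OF g0(2) less.prems(3)] by (auto simp: U_def)
      ultimately show "\<exists>gx\<in>V'. \<exists>gy\<in>V'. act' gx (\<Phi> x) \<in> U' \<and> act' gy (\<Phi> y) \<in> U' \<and>
          (\<forall>b<a. lrsquig K' TK' TX' act' b W' (act' gx (\<Phi> x)) (act' gy (\<Phi> y)))"
        using g0(3,4) by blast
    qed
  qed
qed


section \<open>Sequences in a topological group\<close>

text \<open>A basic open box has all but finitely many sides full, and a coordinate on a full side
  may be changed at will. This is applied both to sequences and to the coordinates of a wreath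
  product.\<close>

lemma openin_product_topology_cofinite:
  assumes "openin (product_topology (\<lambda>_. T) I) U" "x \<in> U"
  obtains F where "finite F" "F \<subseteq> I"
    "\<forall>y \<in> I \<rightarrow>\<^sub>E topspace T. (\<forall>i\<in>F. y i = x i) \<longrightarrow> y \<in> U"
proof -
  obtain X where X: "x \<in> (\<Pi>\<^sub>E i\<in>I. X i)" "finite {i. X i \<noteq> topspace T}" "(\<Pi>\<^sub>E i\<in>I. X i) \<subseteq> U"
    using product_topology_open_contains_basis[OF assms] by blast
  have "y \<in> U" if y: "y \<in> I \<rightarrow>\<^sub>E topspace T" "\<forall>i \<in> I \<inter> {i. X i \<noteq> topspace T}. y i = x i" for y
  proof -
    have "y i \<in> X i" if "i \<in> I" for i
      using y X(1) that by (cases "X i = topspace T") (auto simp: PiE_iff)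
    then have "y \<in> (\<Pi>\<^sub>E i\<in>I. X i)" using y(1) by (auto simp: PiE_iff)
    with X(3) show "y \<in> U" by blast
  qed
  then show thesis
    using X(2) by (intro that[of "I \<inter> {i. X i \<noteq> topspace T}"]) auto
qed

text \<open>The finite set of controlled indices fits into an initial segment. The tails of
  sequences thus stay free in the constructions below.\<close>

lemma openin_seq_topology_initial:
  assumes "openin (seq_topology T) U" "x \<in> U"
  obtains N where "\<forall>y \<in> UNIV \<rightarrow> topspace T. (\<forall>n<N. y n = x n) \<longrightarrow> y \<in> U"
proof -
  obtain F where F: "finite F" "F \<subseteq> UNIV"
    "\<forall>y \<in> UNIV \<rightarrow>\<^sub>E topspace T. (\<forall>n\<in>F. y n = x n) \<longrightarrow> y \<in> U"
    using openin_product_topology_cofinite[OF assms] .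
  obtain N where "F \<subseteq> {..<N}"
    using finite_nat_iff_bounded F(1) by blast
  then have "y \<in> U" if "y \<in> UNIV \<rightarrow> topspace T" "\<forall>n<N. y n = x n" for y
    using that by (intro F(3)[rule_format]) auto
  then show thesis
    by (intro that[of N] ballI impI)
qed

lemma topspace_seq_topology: "topspace (seq_topology T) = UNIV \<rightarrow> topspace T"
  by auto

section \<open>Convergent sequences and neighbourhoods of constants in \<open>c(G)\<close>\<close>

lemma conv_seqs_eventually_const:
  assumes "\<And>n. x n \<in> topspace T" "\<And>n. n \<ge> N \<Longrightarrow> x n = l"
  shows "x \<in> conv_seqs T"
proof -
  have "limitin T x l sequentially"
    using assms by (intro limitin_eventually) (auto simp: eventually_sequentially)
  with assms(1) show ?thesis
    by (auto simp: conv_seqs_def)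
qed

lemma conv_seqs_continuous_image:
  assumes "continuous_map T1 T2 f" "\<gamma> \<in> conv_seqs T1"
  shows "(\<lambda>n. f (\<gamma> n)) \<in> conv_seqs T2"
proof -
  obtain l where "limitin T1 \<gamma> l sequentially" "\<And>n. \<gamma> n \<in> topspace T1"
    using assms(2) by (auto simp: conv_seqs_def)
  then show ?thesis
    using continuous_map_limit[OF assms(1), of \<gamma> l] continuous_map_funspace[OF assms(1)]
    by (auto simp: conv_seqs_def o_def Pi_iff)
qed

text \<open>Together with the next lemma: the convergent sequences with values in a neighbourhood of
  \<open>c\<close> form a neighbourhood base at the constant \<open>c\<close>. After these two
  lemmas the supremum metric is not mentioned again.\<close>

lemma conv_seq_topology_nbhd_const:
  assumes T: "completely_metrizable_space T" and W: "openin (conv_seq_topology T) W" "(\<lambda>_. c) \<in> W"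
  obtains S where "openin T S" "c \<in> S" "{\<gamma> \<in> conv_seqs T. range \<gamma> \<subseteq> S} \<subseteq> W"
proof -
  obtain m where m: "complete_metric_for T m"
    using ex_complete_metric_for[OF T] by blast
  then have mT: "mtopology_of m = T" by (simp add: complete_metric_for_def)
  interpret A: Metric_space "mspace m" "mdist m" by simp
  interpret S: Metric_space "conv_seqs T" "mdist (sup_metric T m)"
    using Metric_space_mspace_mdist[of "sup_metric T m"] mT by (simp add: mspace_sup_metric)
  have "openin S.mtopology W"
    using W m conv_seq_topology_eq[OF m] by (simp add: mtopology_of_def mspace_sup_metric[OF mT])
  then obtain r where r: "r > 0" "S.mball (\<lambda>_. c) r \<subseteq> W" and cc: "(\<lambda>_. c) \<in> conv_seqs T"
    using W(2) unfolding S.openin_mtopology by blast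
  have topA: "A.mtopology = T" using mT by (simp add: mtopology_of_def)
  have c: "c \<in> mspace m"
    using cc topA by (auto simp: conv_seqs_def)
  show thesis
  proof
    \<comment> \<open>The radius is halved because a supremum of distances below \<open>r\<close>
      could equal \<open>r\<close>.\<close>
    show "openin T (A.mball c (r/2))" using topA by (metis A.openin_mball)
    show "c \<in> A.mball c (r/2)" using c r by simp
    show "{\<gamma> \<in> conv_seqs T. range \<gamma> \<subseteq> A.mball c (r/2)} \<subseteq> W"
    proof safe
      fix \<gamma> assume \<gamma>: "\<gamma> \<in> conv_seqs T" "range \<gamma> \<subseteq> A.mball c (r/2)"
      have "mdist (sup_metric T m) (\<lambda>_. c) \<gamma> = (SUP n. mdist m c (\<gamma> n))"
        by (rule mdist_sup_metric[OF mT cc \<gamma>(1)])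
      also have "\<dots> \<le> r/2"
        using \<gamma>(2) by (intro cSUP_least) (auto simp: image_subset_iff intro: less_imp_le)
      finally have "\<gamma> \<in> S.mball (\<lambda>_. c) r" using r cc \<gamma>(1) by simp
      with r show "\<gamma> \<in> W" by blast
    qed
  qed
qed

text \<open>Each coordinate distance is at most the supremum distance, so a supremum ball about the
  constant consists of sequences with values in the ball of the same radius about
  \<open>c\<close>.\<close>

lemma conv_seq_topology_nbhd_const_ex:
  assumes T: "completely_metrizable_space T" and S: "openin T S" "c \<in> S"
  obtains W where "openin (conv_seq_topology T) W" "(\<lambda>_. c) \<in> W"
    "W \<subseteq> {\<gamma> \<in> conv_seqs T. range \<gamma> \<subseteq> S}"
proof -
  obtain m where m: "complete_metric_for T m"
    using ex_complete_metric_for[OF T] by blast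
  then have mT: "mtopology_of m = T" by (simp add: complete_metric_for_def)
  interpret A: Metric_space "mspace m" "mdist m" by simp
  interpret S: Metric_space "conv_seqs T" "mdist (sup_metric T m)"
    using Metric_space_mspace_mdist[of "sup_metric T m"] mT by (simp add: mspace_sup_metric)
  have topA: "A.mtopology = T" using mT by (simp add: mtopology_of_def)
  obtain r where r: "r > 0" "A.mball c r \<subseteq> S"
    using S topA A.openin_mtopology by metis
  have cT: "c \<in> topspace T" using S openin_subset by blast
  have cc: "(\<lambda>_. c) \<in> conv_seqs T"
    using cT by (auto intro: conv_seqs_eventually_const)
  show thesis
  proof
    show "openin (conv_seq_topology T) (S.mball (\<lambda>_. c) r)"
      using S.openin_mball conv_seq_topology_eq[OF m]
      by (simp add: mtopology_of_def mspace_sup_metric[OF mT])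
    show "(\<lambda>_. c) \<in> S.mball (\<lambda>_. c) r" using cc r by simp
    show "S.mball (\<lambda>_. c) r \<subseteq> {\<gamma> \<in> conv_seqs T. range \<gamma> \<subseteq> S}"
    proof safe
      fix \<gamma> n assume "\<gamma> \<in> S.mball (\<lambda>_. c) r"
      then have \<gamma>: "\<gamma> \<in> conv_seqs T" and d: "mdist (sup_metric T m) (\<lambda>_. c) \<gamma> < r" by auto
      have fs: "conv_seqs T \<subseteq> mspace (funspace UNIV m)"
        using mspace_sup_metric[OF mT] by (auto simp: sup_metric_def)
      have "mdist m c (\<gamma> n) \<le> mdist (sup_metric T m) (\<lambda>_. c) \<gamma>"
        using fs cc \<gamma> funspace_mdist_le[where S=UNIV and f="\<lambda>_. c" and m=m and g=\<gamma>
            and a="mdist (funspace UNIV m) (\<lambda>_. c) \<gamma>"]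
        by (auto simp: sup_metric_def)
      with d have "mdist m c (\<gamma> n) < r" by simp
      moreover have "\<gamma> n \<in> mspace m" "c \<in> mspace m"
        using \<gamma> cT topA A.topspace_mtopology by (auto simp: conv_seqs_def)
      ultimately show "\<gamma> n \<in> S" using r by auto
    qed auto
  qed
qed

text \<open>Compactness gives a cluster point \<open>a\<close>. As \<open>z\<close> does not
  converge to \<open>a\<close>, infinitely many terms avoid some open \<open>U\<close> around
  \<open>a\<close>, and a convergent subsequence of these has its limit outside
  \<open>U\<close>.\<close>

lemma two_cluster_points:
  assumes T: "metrizable_space T" and C: "compactin T C"
    and z: "range z \<subseteq> C" "\<nexists>l. limitin T z l sequentially"
  obtains r s :: "nat \<Rightarrow> nat" and a b where "strict_mono r" "strict_mono s" "a \<noteq> b"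
    "limitin T (z \<circ> r) a sequentially" "limitin T (z \<circ> s) b sequentially"
proof -
  obtain M d where "Metric_space M d" and Td: "T = Metric_space.mtopology M d"
    using T by (auto simp: metrizable_space_def)
  interpret Metric_space M d by fact
  have sub: "\<exists>l r. l \<in> C \<and> strict_mono r \<and> limitin T (\<sigma> \<circ> r) l sequentially"
    if "range \<sigma> \<subseteq> C" for \<sigma> :: "nat \<Rightarrow> 'a"
    using C that unfolding Td compactin_sequentially by blast
  obtain a r where a: "a \<in> C" "strict_mono r" "limitin T (z \<circ> r) a sequentially"
    using sub[OF z(1)] by blast
  have aT: "a \<in> topspace T" using a(3) by (rule limitin_topspace)
  obtain U where U: "openin T U" "a \<in> U" "\<not> (\<forall>\<^sub>F n in sequentially. z n \<in> U)"
    using z(2) aT unfolding limitin_def by blast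
  define A where "A = {n. z n \<notin> U}"
  have "infinite A"
    using U(3) unfolding A_def eventually_sequentially infinite_nat_iff_unbounded_le by auto
  have "range (z \<circ> enumerate A) \<subseteq> C" using z(1) by auto
  then obtain b s where b: "strict_mono s" "limitin T ((z \<circ> enumerate A) \<circ> s) b sequentially"
    using sub by blast
  have "strict_mono (enumerate A \<circ> s)"
    using \<open>infinite A\<close> b(1) strict_mono_enumerate strict_mono_o by blast
  moreover have "b \<notin> U"
  proof
    assume "b \<in> U"
    then have "\<forall>\<^sub>F n in sequentially. z (enumerate A (s n)) \<in> U"
      using b(2) U(1) by (auto simp: limitin_def)
    moreover have "z (enumerate A (s n)) \<notin> U" for n
      using enumerate_in_set[OF \<open>infinite A\<close>] by (auto simp: A_def)
    ultimately show False by simp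
  qed
  ultimately show thesis
    using that[OF a(2) _ _ a(3), of "enumerate A \<circ> s" b] U(2) b(2) by (auto simp: comp_assoc)
qed


text \<open>Instantiated both for \<open>G\<close> and for the wreath product \<open>H\<close>, so
  that its lemmas are available on both sides of the transfer. Complete metrizability supplies the
  metric behind \<open>conv_seq_topology\<close>.\<close>

locale completely_metrizable_group = topological_group +
  assumes completely_metrizable: "completely_metrizable_space T"
begin

lemma metrizable: "metrizable_space T"
  using completely_metrizable by (rule completely_metrizable_imp_metrizable_space)

lemma Hausdorff: "Hausdorff_space T"
  using metrizable by (rule metrizable_imp_Hausdorff_space)

lemma mult_inv_cancel [simp]: "\<lbrakk>a \<in> carrier G; b \<in> carrier G\<rbrakk> \<Longrightarrow> a \<otimes> (inv a \<otimes> b) = b"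
  by (simp flip: m_assoc)

lemma inv_mult_cancel [simp]: "\<lbrakk>a \<in> carrier G; b \<in> carrier G\<rbrakk> \<Longrightarrow> inv a \<otimes> (a \<otimes> b) = b"
  by (simp flip: m_assoc)

lemma continuous_map_mult:
  assumes "continuous_map X T f" "continuous_map X T g"
  shows "continuous_map X T (\<lambda>z. f z \<otimes> g z)"
  using continuous_map_compose[OF continuous_map_pairedI[OF assms] continuous_mult]
  by (simp add: o_def)

lemma continuous_map_inv:
  assumes "continuous_map X T f"
  shows "continuous_map X T (\<lambda>z. inv f z)"
  using continuous_map_compose[OF assms continuous_inv] by (simp add: o_def)

lemma continuous_map_const_carrier: "c \<in> carrier G \<Longrightarrow> continuous_map X T (\<lambda>z. c)"
  by (simp add: topspace_eq)

lemma limitin_carrier: "limitin T f a F \<Longrightarrow> a \<in> carrier G"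
  using limitin_topspace topspace_eq by metis

lemma limitin_mult:
  assumes "limitin T f a F" "limitin T g b F"
  shows "limitin T (\<lambda>n. f n \<otimes> g n) (a \<otimes> b) F"
proof -
  have "limitin (prod_topology T T) (\<lambda>n. (f n, g n)) (a, b) F"
    using assms by (simp add: limitin_pairwise o_def)
  from continuous_map_limit[OF continuous_mult this] show ?thesis
    by (simp add: o_def)
qed

lemma limitin_inv:
  assumes "limitin T f a F"
  shows "limitin T (\<lambda>n. inv f n) (inv a) F"
  using continuous_map_limit[OF continuous_inv assms] by (simp add: o_def)

section \<open>The action of \<open>c(G)\<close> on sequences and the relation at level 0\<close>

lemma conv_seqsD:
  assumes "\<gamma> \<in> conv_seqs T"
  shows "\<gamma> n \<in> carrier G" "\<exists>l. limitin T \<gamma> l sequentially"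
  using assms topspace_eq by (auto simp: conv_seqs_def)

lemma seq_mult_carrier:
  "\<lbrakk>\<gamma> \<in> conv_seqs T; x \<in> UNIV \<rightarrow> carrier G\<rbrakk> \<Longrightarrow> seq_mult G \<gamma> x \<in> UNIV \<rightarrow> carrier G"
  by (auto simp: seq_mult_def conv_seqsD Pi_iff)

text \<open>The original quotient is the moved one multiplied by \<open>inv \<gamma> n\<close> on
  the left and \<open>\<delta> n\<close> on the right, and both factors converge. Inequivalence
  therefore survives moves by two different elements of \<open>c(G)\<close>.\<close>

lemma E_rel_seq_multD:
  assumes "\<gamma> \<in> conv_seqs T" "\<delta> \<in> conv_seqs T" "x \<in> UNIV \<rightarrow> carrier G" "y \<in> UNIV \<rightarrow> carrier G"
    and "(seq_mult G \<gamma> x, seq_mult G \<delta> y) \<in> E_rel G T"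
  shows "(x, y) \<in> E_rel G T"
proof -
  obtain l c d where l: "limitin T (\<lambda>n. seq_mult G \<gamma> x n \<otimes> inv seq_mult G \<delta> y n) l sequentially"
    and c: "limitin T \<gamma> c sequentially" and d: "limitin T \<delta> d sequentially"
    using assms(5) conv_seqsD(2)[OF assms(1)] conv_seqsD(2)[OF assms(2)] by (auto simp: E_rel_def)
  have "limitin T (\<lambda>n. inv \<gamma> n \<otimes> ((seq_mult G \<gamma> x n \<otimes> inv seq_mult G \<delta> y n) \<otimes> \<delta> n))
          (inv c \<otimes> (l \<otimes> d)) sequentially"
    by (intro limitin_mult limitin_inv l c d)
  moreover have "inv \<gamma> n \<otimes> ((seq_mult G \<gamma> x n \<otimes> inv seq_mult G \<delta> y n) \<otimes> \<delta> n) = x n \<otimes> inv y n" for n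
  proof -
    have "\<gamma> n \<in> carrier G" "\<delta> n \<in> carrier G" "x n \<in> carrier G" "y n \<in> carrier G"
      using assms conv_seqsD by auto
    then show ?thesis
      by (simp add: seq_mult_def m_assoc inv_mult_group)
  qed
  ultimately have "\<exists>l. limitin T (\<lambda>n. x n \<otimes> inv y n) l sequentially"
    by auto
  then show ?thesis
    using assms by (simp add: E_rel_def)
qed

abbreviation squig :: "omega1 \<Rightarrow> (nat \<Rightarrow> 'a) set \<Rightarrow> (nat \<Rightarrow> 'a) \<Rightarrow> (nat \<Rightarrow> 'a) \<Rightarrow> bool" where
  "squig \<equiv> lrsquig (conv_seq_group G T) (conv_seq_topology T) (seq_topology T) (seq_mult G)"

text \<open>A neighbourhood of \<open>y\<close> sees finitely many entries, so the sequence of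
  quotients may be cut off and continued by \<open>\<one>\<close>. The result lies in
  \<open>c(G)\<close> even if the quotients diverge.\<close>

lemma in_closure_of_seq_multI:
  assumes V: "{\<gamma> \<in> conv_seqs T. range \<gamma> \<subseteq> S} \<subseteq> V" and "\<one> \<in> S"
    and x: "x \<in> UNIV \<rightarrow> carrier G" and y: "y \<in> UNIV \<rightarrow> carrier G"
    and S: "\<And>n. y n \<otimes> inv x n \<in> S"
  shows "y \<in> seq_topology T closure_of ((\<lambda>g. seq_mult G g x) ` V)"
  unfolding in_closure_of
proof (intro conjI allI impI)
  show "y \<in> topspace (seq_topology T)"
    unfolding topspace_seq_topology topspace_eq by (fact y)
  fix U assume U: "y \<in> U \<and> openin (seq_topology T) U"
  then obtain N where N: "\<forall>z \<in> UNIV \<rightarrow> topspace T. (\<forall>n<N. z n = y n) \<longrightarrow> z \<in> U"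
    using openin_seq_topology_initial by metis
  define w where "w n = (if n < N then y n \<otimes> inv x n else \<one>)" for n
  have xy: "x n \<in> carrier G" "y n \<in> carrier G" for n
    using x y by auto
  have wc: "w \<in> conv_seqs T"
    using xy by (intro conv_seqs_eventually_const[of _ _ N \<one>]) (auto simp: w_def topspace_eq)
  moreover have "range w \<subseteq> S"
    using S \<open>\<one> \<in> S\<close> by (auto simp: w_def)
  ultimately have "w \<in> V"
    using V by blast
  moreover have "seq_mult G w x \<in> U"
  proof (rule N[rule_format])
    show "seq_mult G w x \<in> UNIV \<rightarrow> topspace T"
      using seq_mult_carrier[OF wc x] by (simp add: topspace_eq)
    show "seq_mult G w x n = y n" if "n < N" for n
      using that xy[of n] by (simp add: seq_mult_def w_def m_assoc)
  qed
  ultimately show "\<exists>z. z \<in> (\<lambda>g. seq_mult G g x) ` V \<and> z \<in> U" by blast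
qed

text \<open>The continuous map \<open>\<lambda>z. z n \<otimes> inv x n\<close> sends
  \<open>seq_mult G \<gamma> x\<close> to \<open>\<gamma> n\<close>, hence the orbit into
  \<open>S\<close>. With the previous lemma, level 0 for a small neighbourhood means, up to closure,
  that all quotients are small.\<close>

lemma in_closure_of_seq_multD:
  assumes V: "V \<subseteq> {\<gamma> \<in> conv_seqs T. range \<gamma> \<subseteq> S}" and S: "S \<subseteq> carrier G"
    and x: "x \<in> UNIV \<rightarrow> carrier G"
    and "y \<in> seq_topology T closure_of ((\<lambda>g. seq_mult G g x) ` V)"
  shows "y n \<otimes> inv x n \<in> T closure_of S"
proof -
  have xn: "x n \<in> carrier G" using x by auto
  have "continuous_map (seq_topology T) T (\<lambda>z. z n \<otimes> inv x n)"
    using xn by (intro continuous_map_mult continuous_map_product_projection continuous_map_const_carrier) simp_all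
  from continuous_map_image_closure_subset[OF this] assms(4)
  have "y n \<otimes> inv x n \<in> T closure_of ((\<lambda>z. z n \<otimes> inv x n) ` (\<lambda>g. seq_mult G g x) ` V)"
    by blast
  moreover have "(\<lambda>z. z n \<otimes> inv x n) ` (\<lambda>g. seq_mult G g x) ` V \<subseteq> S"
  proof safe
    fix \<gamma> assume "\<gamma> \<in> V"
    then have "\<gamma> n \<in> S" using V by blast
    moreover from this have "\<gamma> n \<in> carrier G" using S by blast
    ultimately show "seq_mult G \<gamma> x n \<otimes> inv x n \<in> S"
      using xn by (simp add: seq_mult_def m_assoc)
  qed
  ultimately show ?thesis using closure_of_mono by blast
qed

lemma nbhd_one_ex:
  assumes "openin T S" "\<one> \<in> S"
  obtains W where "openin (conv_seq_topology T) W" "\<one>\<^bsub>conv_seq_group G T\<^esub> \<in> W"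
    "W \<subseteq> {\<gamma> \<in> conv_seqs T. range \<gamma> \<subseteq> S}"
  by (rule conv_seq_topology_nbhd_const_ex[OF completely_metrizable assms])
    (simp add: conv_seq_group_def)

lemma nbhd_one_contains:
  assumes "openin (conv_seq_topology T) W" "\<one>\<^bsub>conv_seq_group G T\<^esub> \<in> W"
  obtains S where "openin T S" "\<one> \<in> S" "{\<gamma> \<in> conv_seqs T. range \<gamma> \<subseteq> S} \<subseteq> W"
proof (rule conv_seq_topology_nbhd_const[OF completely_metrizable assms(1)])
  show "(\<lambda>_. \<one>) \<in> W" using assms(2) by (simp add: conv_seq_group_def)
qed (rule that)

lemma topspace_seq_eq: "topspace (seq_topology T) = UNIV \<rightarrow> carrier G"
  unfolding topspace_seq_topology topspace_eq ..

text \<open>Continuity of division at \<open>(\<one>, \<one>)\<close>, then regularity of a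
  metrizable space. \<open>Q\<close> is closed because it has to contain the closure of
  \<open>S\<close>, where level 0 puts the quotients, as well as limits of these quotients.\<close>

lemma nbhd_one_closed_div:
  assumes "openin T N" "\<one> \<in> N"
  obtains S Q where "openin T S" "\<one> \<in> S" "closedin T Q" "S \<subseteq> Q"
    "\<forall>a\<in>Q. \<forall>b\<in>Q. a \<otimes> inv b \<in> N"
proof -
  have cont: "continuous_map (prod_topology T T) T (\<lambda>p. fst p \<otimes> inv snd p)"
    by (intro continuous_map_mult continuous_map_inv continuous_map_fst continuous_map_snd)
  define P where "P = {p \<in> topspace (prod_topology T T). fst p \<otimes> inv snd p \<in> N}"
  have "openin (prod_topology T T) P" unfolding P_def
    by (rule openin_continuous_map_preimage[OF cont assms(1)])
  moreover have "(\<one>, \<one>) \<in> P" using assms(2) by (simp add: P_def topspace_eq)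
  ultimately have "\<exists>A B. openin T A \<and> openin T B \<and> \<one> \<in> A \<and> \<one> \<in> B \<and> A \<times> B \<subseteq> P"
    by (simp add: openin_prod_topology_alt)
  then obtain A B where AB: "openin T A" "openin T B" "\<one> \<in> A" "\<one> \<in> B" "A \<times> B \<subseteq> P"
    by (elim exE conjE)
  have nb: "neighbourhood_base_of (closedin T) T"
    using metrizable_imp_regular_space[OF metrizable] by (simp add: neighbourhood_base_of_closedin)
  have "openin T (A \<inter> B) \<and> \<one> \<in> A \<inter> B" using AB by auto
  then have "\<exists>S Q. openin T S \<and> closedin T Q \<and> \<one> \<in> S \<and> S \<subseteq> Q \<and> Q \<subseteq> A \<inter> B"
    by (rule nb[unfolded neighbourhood_base_of, rule_format])
  then obtain S Q where SQ: "openin T S" "closedin T Q" "\<one> \<in> S" "S \<subseteq> Q" "Q \<subseteq> A \<inter> B"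
    by (elim exE conjE)
  have "a \<otimes> inv b \<in> N" if "a \<in> A \<inter> B" "b \<in> A \<inter> B" for a b
    using AB(5) that by (auto simp: P_def)
  with SQ(5) have "\<forall>a\<in>Q. \<forall>b\<in>Q. a \<otimes> inv b \<in> N"
    by (meson subsetD)
  then show thesis
    by (rule that[OF SQ(1,3,2,4)])
qed

text \<open>Level 0 for a small \<open>W\<close> puts the moved quotients into \<open>Q\<close>. If
  \<open>\<gamma>\<close> tends to \<open>p\<close> and \<open>\<delta>\<close> to \<open>q\<close>,
  the limits along \<open>r\<close> and \<open>s\<close> are
  \<open>p \<otimes> a \<otimes> inv q\<close> and \<open>p \<otimes> b \<otimes> inv q\<close>;
  dividing one by the other removes \<open>q\<close>. That \<open>\<gamma>\<close> comes from
  \<open>V\<close> is recorded because at level 2 it confines \<open>p\<close> to a compact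
  set.\<close>

lemma squig_one_conjugate_small:
  assumes sq: "squig (osuc 0) V x y" and V: "V \<subseteq> conv_seqs T"
    and x: "x \<in> UNIV \<rightarrow> carrier G" and y: "y \<in> UNIV \<rightarrow> carrier G"
    and r: "strict_mono (r :: nat \<Rightarrow> nat)" "limitin T (\<lambda>n. x (r n) \<otimes> inv y (r n)) a sequentially"
    and s: "strict_mono (s :: nat \<Rightarrow> nat)" "limitin T (\<lambda>n. x (s n) \<otimes> inv y (s n)) b sequentially"
    and N: "openin T N" "\<one> \<in> N"
  obtains \<gamma> p where "\<gamma> \<in> V" "limitin T \<gamma> p sequentially" "p \<otimes> (a \<otimes> inv b) \<otimes> inv p \<in> N"
proof -
  obtain S Q where SQ: "openin T S" "\<one> \<in> S" "closedin T Q" "S \<subseteq> Q"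
    "\<forall>a\<in>Q. \<forall>b\<in>Q. a \<otimes> inv b \<in> N"
    by (rule nbhd_one_closed_div[OF N])
  obtain W where W: "openin (conv_seq_topology T) W" "\<one>\<^bsub>conv_seq_group G T\<^esub> \<in> W"
    and W3: "W \<subseteq> {\<gamma> \<in> conv_seqs T. range \<gamma> \<subseteq> S}"
    by (rule nbhd_one_ex[OF SQ(1,2)])
  \<comment> \<open>The open set of the relation is taken to be the whole space; the information
    lies in the choice of \<open>W\<close>.\<close>
  have "x \<in> topspace (seq_topology T) \<or> y \<in> topspace (seq_topology T)"
    unfolding topspace_seq_eq using x ..
  then obtain \<gamma> \<delta> where gd: "\<gamma> \<in> V" "\<delta> \<in> V"
    and "seq_mult G \<gamma> x \<in> topspace (seq_topology T)" "seq_mult G \<delta> y \<in> topspace (seq_topology T)"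
    and sqW: "\<forall>b\<le>0. squig b W (seq_mult G \<gamma> x) (seq_mult G \<delta> y)"
    by (rule lrsquig_osucD[OF sq W(1,2) openin_topspace])
  have c: "\<gamma> \<in> conv_seqs T" "\<delta> \<in> conv_seqs T" using gd V by auto
  obtain p q where p: "limitin T \<gamma> p sequentially" and q: "limitin T \<delta> q sequentially"
    using c conv_seqsD(2) by blast
  have "S \<subseteq> carrier G" using SQ(1) openin_subset topspace_eq by blast
  have inQ: "\<gamma> n \<otimes> (x n \<otimes> inv y n) \<otimes> inv \<delta> n \<in> Q" for n
  proof -
    have "seq_mult G \<gamma> x n \<otimes> inv seq_mult G \<delta> y n \<in> T closure_of S"
      using in_closure_of_seq_multD[OF W3 \<open>S \<subseteq> carrier G\<close> seq_mult_carrier[OF c(2) y]] sqW[rule_format, OF order_refl]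
      by (simp add: lrsquig_zero)
    moreover have "T closure_of S \<subseteq> Q" using SQ by (simp add: closure_of_minimal)
    moreover have "\<gamma> n \<in> carrier G" "\<delta> n \<in> carrier G" "x n \<in> carrier G" "y n \<in> carrier G"
      using c x y conv_seqsD by auto
    ultimately show ?thesis
      by (auto simp: seq_mult_def m_assoc inv_mult_group)
  qed
  have lim: "p \<otimes> e \<otimes> inv q \<in> Q"
    if "strict_mono (t :: nat \<Rightarrow> nat)" "limitin T (\<lambda>n. x (t n) \<otimes> inv y (t n)) e sequentially" for t e
  proof (rule limitin_closedin[OF _ SQ(3)])
    show "limitin T (\<lambda>n. \<gamma> (t n) \<otimes> (x (t n) \<otimes> inv y (t n)) \<otimes> inv \<delta> (t n)) (p \<otimes> e \<otimes> inv q) sequentially"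
      using limitin_subsequence[OF that(1) p] limitin_subsequence[OF that(1) q]
      by (intro limitin_mult limitin_inv that(2)) (simp_all add: o_def)
  qed (use inQ in auto)
  have "a \<in> carrier G" "b \<in> carrier G" "p \<in> carrier G" "q \<in> carrier G"
    using limitin_carrier r(2) s(2) p q by auto
  then have "p \<otimes> (a \<otimes> inv b) \<otimes> inv p = (p \<otimes> a \<otimes> inv q) \<otimes> inv (p \<otimes> b \<otimes> inv q)"
    by (simp add: m_assoc inv_mult_group)
  then have "p \<otimes> (a \<otimes> inv b) \<otimes> inv p \<in> N"
    using SQ(5)[rule_format, OF lim[OF r] lim[OF s]] by simp
  show thesis by (rule that) fact+
qed

text \<open>The witness is eventually constant, hence convergent. The initial segment steers the
  sequence into a given open set while the tail undergoes one fixed translation.\<close>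

lemma seq_in_orbit:
  assumes x: "x \<in> UNIV \<rightarrow> carrier G" and p: "p \<in> UNIV \<rightarrow> carrier G" and g: "g \<in> carrier G"
  obtains \<gamma> where "\<gamma> \<in> conv_seqs T" "seq_mult G \<gamma> x = (\<lambda>n. if n < N then p n else g \<otimes> x n)"
proof
  let ?\<gamma> = "\<lambda>n. if n < N then p n \<otimes> inv x n else g"
  have xy: "x n \<in> carrier G" "p n \<in> carrier G" for n
    using x p by auto
  show "?\<gamma> \<in> conv_seqs T"
    using xy g by (intro conv_seqs_eventually_const[of _ _ N g]) (auto simp: topspace_eq)
  show "seq_mult G ?\<gamma> x = (\<lambda>n. if n < N then p n else g \<otimes> x n)"
    using xy by (auto simp: seq_mult_def m_assoc)
qed

section \<open>Distality and the levels 1 and 2\<close>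

lemma carrier_conv_seq_group: "carrier (conv_seq_group G T) = conv_seqs T"
  by (simp add: conv_seq_group_def)

text \<open>Both sequences are moved to a common initial segment and multiplied by the same
  \<open>g\<close> on the tail. Their quotients are then \<open>\<one>\<close> or conjugates by
  \<open>g\<close> of \<open>h\<close> or \<open>inv h\<close>, which are small for suitable
  \<open>g\<close>.\<close>

lemma not_distal_imp_unbalanced:
  assumes "\<not> distal G T"
  shows "unbalanced (osuc 0) G T"
proof -
  obtain h where h: "h \<in> carrier G" "h \<noteq> \<one>"
    and cl: "\<one> \<in> T closure_of {g \<otimes> h \<otimes> inv g | g. g \<in> carrier G}"
    using assms by (auto simp: distal_def)
  define x where "x = (\<lambda>n::nat. \<one>)"
  define y where "y = (\<lambda>n::nat. if even n then \<one> else h)"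
  have x: "x \<in> UNIV \<rightarrow> carrier G" and y: "y \<in> UNIV \<rightarrow> carrier G"
    using h by (auto simp: x_def y_def)
  have "(x, y) \<notin> E_rel G T"
  proof
    assume "(x, y) \<in> E_rel G T"
    then obtain l where l: "limitin T (\<lambda>n. x n \<otimes> inv y n) l sequentially"
      by (auto simp: E_rel_def)
    \<comment> \<open>The quotient is constant along the even and along the odd indices, so
      \<open>l\<close> would have to equal both constants.\<close>
    have "limitin T (\<lambda>n. \<one>) l sequentially"
      using limitin_subsequence[OF _ l, of "\<lambda>n. 2 * n"]
      by (simp add: o_def x_def y_def strict_mono_def)
    moreover have "limitin T (\<lambda>n. inv h) l sequentially"
      using limitin_subsequence[OF _ l, of "\<lambda>n. 2 * n + 1"] h
      by (simp add: o_def x_def y_def strict_mono_def)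
    moreover have "limitin T (\<lambda>n. \<one>) \<one> sequentially" "limitin T (\<lambda>n. inv h) (inv h) sequentially"
      using h by (auto simp: topspace_eq)
    ultimately have "inv h = \<one>"
      using limitin_Hausdorff_unique[OF _ _ _ Hausdorff] by (metis trivial_limit_sequentially)
    with h show False by (metis inv_inv inv_one)
  qed
  moreover have "squig (osuc 0) (conv_seqs T) x y"
    unfolding lrsquig_pos[OF osuc_neq_0]
  proof (intro allI impI)
    fix W U
    assume asm: "openin (conv_seq_topology T) W \<and> \<one>\<^bsub>conv_seq_group G T\<^esub> \<in> W \<and>
      openin (seq_topology T) U \<and> (x \<in> U \<or> y \<in> U)"
    then obtain S where S: "openin T S" "\<one> \<in> S"
      "{\<gamma> \<in> conv_seqs T. range \<gamma> \<subseteq> S} \<subseteq> W"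
      using nbhd_one_contains[of W] by blast
    \<comment> \<open>One of \<open>x\<close> and \<open>y\<close> serves as \<open>p\<close>; both
      sequences will be given its initial segment.\<close>
    obtain p where p: "p \<in> U" "p \<in> UNIV \<rightarrow> carrier G"
      using asm x y by blast
    obtain N where N: "\<forall>z \<in> UNIV \<rightarrow> carrier G. (\<forall>n<N. z n = p n) \<longrightarrow> z \<in> U"
      using openin_seq_topology_initial[of T U p] asm p(1) topspace_eq by metis
    \<comment> \<open>Level 0 asks for closure in both directions, so the conjugate and its inverse
      must both lie in \<open>S\<close>.\<close>
    define S' where "S' = S \<inter> {g \<in> topspace T. inv g \<in> S}"
    have "openin T S'" "\<one> \<in> S'"
      using S openin_continuous_map_preimage[OF continuous_inv S(1)] by (auto simp: S'_def topspace_eq)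
    then obtain g where g: "g \<in> carrier G" "g \<otimes> h \<otimes> inv g \<in> S'"
      using cl unfolding in_closure_of by blast
    obtain \<gamma> where \<gamma>: "\<gamma> \<in> conv_seqs T" "seq_mult G \<gamma> x = (\<lambda>n. if n < N then p n else g \<otimes> x n)"
      using seq_in_orbit[OF x p(2) g(1)] .
    obtain \<delta> where \<delta>: "\<delta> \<in> conv_seqs T" "seq_mult G \<delta> y = (\<lambda>n. if n < N then p n else g \<otimes> y n)"
      using seq_in_orbit[OF y p(2) g(1)] .
    have car: "seq_mult G \<gamma> x \<in> UNIV \<rightarrow> carrier G" "seq_mult G \<delta> y \<in> UNIV \<rightarrow> carrier G"
      by (rule seq_mult_carrier[OF \<gamma>(1) x], rule seq_mult_carrier[OF \<delta>(1) y])
    have pn: "p n \<in> carrier G" for n using p by auto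
    have "inv (g \<otimes> h \<otimes> inv g) = g \<otimes> (inv h \<otimes> inv g)"
      using g h by (simp add: inv_mult_group m_assoc)
    then have gS: "g \<otimes> (h \<otimes> inv g) \<in> S" "g \<otimes> (inv h \<otimes> inv g) \<in> S"
      using g h by (auto simp: S'_def m_assoc)
    have "squig 0 W (seq_mult G \<gamma> x) (seq_mult G \<delta> y)"
      unfolding lrsquig_zero
    proof (intro conjI in_closure_of_seq_multI[OF S(3,2)] car)
      fix n
      show "seq_mult G \<delta> y n \<otimes> inv seq_mult G \<gamma> x n \<in> S"
        unfolding \<gamma>(2) \<delta>(2) using pn g h S gS by (simp add: x_def y_def m_assoc)
      show "seq_mult G \<gamma> x n \<otimes> inv seq_mult G \<delta> y n \<in> S"
        unfolding \<gamma>(2) \<delta>(2) using pn g h S gS by (simp add: x_def y_def inv_mult_group m_assoc)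
    qed
    moreover have "seq_mult G \<gamma> x \<in> U" "seq_mult G \<delta> y \<in> U"
      using N car \<gamma>(2) \<delta>(2) by simp_all
    ultimately show "\<exists>gx\<in>conv_seqs T. \<exists>gy\<in>conv_seqs T. seq_mult G gx x \<in> U \<and> seq_mult G gy y \<in> U \<and>
        (\<forall>b<osuc 0. squig b W (seq_mult G gx x) (seq_mult G gy y))"
      using \<gamma>(1) \<delta>(1) zero_le_omega1 by (auto simp: less_osuc_iff dest: antisym)
  qed
  ultimately show ?thesis
    using x y by (auto simp: unbalanced_def carrier_conv_seq_group)
qed

lemma compact_cluster_points:
  assumes "compactin T C"
    and x: "x \<in> UNIV \<rightarrow> carrier G" and y: "y \<in> UNIV \<rightarrow> carrier G" and "(x, y) \<notin> E_rel G T"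
    and "\<And>n. x n \<otimes> inv y n \<in> C"
  obtains r s :: "nat \<Rightarrow> nat" and a b where "strict_mono r" "strict_mono s" "a \<noteq> b"
    "limitin T (\<lambda>n. x (r n) \<otimes> inv y (r n)) a sequentially"
    "limitin T (\<lambda>n. x (s n) \<otimes> inv y (s n)) b sequentially"
proof -
  let ?z = "\<lambda>n. x n \<otimes> inv y n"
  have z: "range ?z \<subseteq> C" "\<nexists>l. limitin T ?z l sequentially"
    using assms by (auto simp: E_rel_def)
  obtain r s :: "nat \<Rightarrow> nat" and a b where "strict_mono r" "strict_mono s" "a \<noteq> b"
    "limitin T (?z \<circ> r) a sequentially" "limitin T (?z \<circ> s) b sequentially"
    using two_cluster_points[OF metrizable assms(1) z] .
  then show thesis
    by (intro that[of r s a b]) (simp_all add: o_def)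
qed

lemma mult_inv_eq_one_iff:
  assumes "a \<in> carrier G" "b \<in> carrier G"
  shows "a \<otimes> inv b = \<one> \<longleftrightarrow> a = b"
  using assms by (metis inv_closed inv_inv inv_equality r_inv)

text \<open>The first move shared by the arguments at levels 1 and 2. Level 0 for the moved pair
  confines its quotients to \<open>C\<close>, which will be compact; level \<open>a\<close> remains
  available over a \<open>V\<close> whose members take values in \<open>S\<close>.\<close>

lemma squig_osuc_closed_nbhd:
  assumes sq: "squig (osuc a) (conv_seqs T) x y"
    and x: "x \<in> UNIV \<rightarrow> carrier G" and y: "y \<in> UNIV \<rightarrow> carrier G"
    and S: "openin T S" "\<one> \<in> S" "S \<subseteq> C" "closedin T C"
  obtains \<gamma> \<delta> V where "\<gamma> \<in> conv_seqs T" "\<delta> \<in> conv_seqs T"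
    "V \<subseteq> {\<gamma> \<in> conv_seqs T. range \<gamma> \<subseteq> S}" "squig a V (seq_mult G \<gamma> x) (seq_mult G \<delta> y)"
    "\<forall>n. seq_mult G \<gamma> x n \<otimes> inv seq_mult G \<delta> y n \<in> C"
proof -
  obtain V where V: "openin (conv_seq_topology T) V" "\<one>\<^bsub>conv_seq_group G T\<^esub> \<in> V"
    "V \<subseteq> {\<gamma> \<in> conv_seqs T. range \<gamma> \<subseteq> S}"
    by (rule nbhd_one_ex[OF S(1,2)])
  have "x \<in> topspace (seq_topology T) \<or> y \<in> topspace (seq_topology T)"
    unfolding topspace_seq_eq using x ..
  then obtain \<gamma> \<delta> where gd: "\<gamma> \<in> conv_seqs T" "\<delta> \<in> conv_seqs T"
    and "seq_mult G \<gamma> x \<in> topspace (seq_topology T)" "seq_mult G \<delta> y \<in> topspace (seq_topology T)"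
    and sqV: "\<forall>b\<le>a. squig b V (seq_mult G \<gamma> x) (seq_mult G \<delta> y)"
    by (rule lrsquig_osucD[OF sq V(1,2) openin_topspace])
  have "S \<subseteq> carrier G" using S(1) openin_subset topspace_eq by blast
  then have "seq_mult G \<gamma> x n \<otimes> inv seq_mult G \<delta> y n \<in> T closure_of S" for n
    using in_closure_of_seq_multD[OF V(3) _ seq_mult_carrier[OF gd(2) y]] sqV[rule_format, OF zero_le_omega1]
    by (simp add: lrsquig_zero)
  moreover have "T closure_of S \<subseteq> C" using S by (simp add: closure_of_minimal)
  ultimately have inC: "seq_mult G \<gamma> x n \<otimes> inv seq_mult G \<delta> y n \<in> C" for n by blast
  then show thesis
    using that[OF gd V(3) sqV[rule_format, OF order_refl]] by blast
qed

lemma locally_compact_one: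
  assumes "locally_compact_space T"
  obtains S C where "openin T S" "\<one> \<in> S" "S \<subseteq> C" "closedin T C" "compactin T C"
  using assms Hausdorff locally_compact_space_compact_closedin[of T] topspace_eq one_closed by metis

text \<open>The quotients are confined to a compact set for the moved pair, but level 1 is known for
  the original pair. So two cluster points are found after the move and carried back through the
  limits \<open>c\<close> and \<open>d\<close> of \<open>\<gamma>\<close> and
  \<open>\<delta>\<close>; they stay distinct, and their quotient \<open>h\<close> has conjugates in
  every neighbourhood of \<open>\<one>\<close>.\<close>

lemma unbalanced_one_imp_not_distal:
  assumes "locally_compact_space T" "unbalanced (osuc 0) G T"
  shows "\<not> distal G T"
proof -
  obtain x y where x: "x \<in> UNIV \<rightarrow> carrier G" and y: "y \<in> UNIV \<rightarrow> carrier G"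
    and sq: "squig (osuc 0) (conv_seqs T) x y" and nE: "(x, y) \<notin> E_rel G T"
    using assms(2) by (auto simp: unbalanced_def carrier_conv_seq_group)
  obtain S C where SC: "openin T S" "\<one> \<in> S" "S \<subseteq> C" "closedin T C" "compactin T C"
    using locally_compact_one[OF assms(1)] .
  obtain \<gamma> \<delta> V where gd: "\<gamma> \<in> conv_seqs T" "\<delta> \<in> conv_seqs T"
    and "V \<subseteq> {\<gamma> \<in> conv_seqs T. range \<gamma> \<subseteq> S}" "squig 0 V (seq_mult G \<gamma> x) (seq_mult G \<delta> y)"
    and inC: "\<forall>n. seq_mult G \<gamma> x n \<otimes> inv seq_mult G \<delta> y n \<in> C"
    using squig_osuc_closed_nbhd[OF sq x y SC(1-4)] .
  let ?x = "seq_mult G \<gamma> x" and ?y = "seq_mult G \<delta> y"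
  have nE': "(?x, ?y) \<notin> E_rel G T"
    using nE E_rel_seq_multD[OF gd x y] by blast
  obtain r s :: "nat \<Rightarrow> nat" and a b where rs: "strict_mono r" "strict_mono s" "a \<noteq> b"
    "limitin T (\<lambda>n. ?x (r n) \<otimes> inv ?y (r n)) a sequentially"
    "limitin T (\<lambda>n. ?x (s n) \<otimes> inv ?y (s n)) b sequentially"
    using compact_cluster_points[OF SC(5) seq_mult_carrier[OF gd(1) x] seq_mult_carrier[OF gd(2) y]
        nE' inC[rule_format]] .
  obtain c d where c: "limitin T \<gamma> c sequentially" and d: "limitin T \<delta> d sequentially"
    using gd conv_seqsD(2) by blast
  have lim: "limitin T (\<lambda>n. x (t n) \<otimes> inv y (t n)) (inv c \<otimes> (e \<otimes> d)) sequentially"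
    if t: "strict_mono (t :: nat \<Rightarrow> nat)"
      and e: "limitin T (\<lambda>n. ?x (t n) \<otimes> inv ?y (t n)) e sequentially" for t e
  proof -
    have "limitin T (\<lambda>n. inv \<gamma> (t n) \<otimes> ((?x (t n) \<otimes> inv ?y (t n)) \<otimes> \<delta> (t n)))
        (inv c \<otimes> (e \<otimes> d)) sequentially"
      using limitin_subsequence[OF t c] limitin_subsequence[OF t d]
      by (intro limitin_mult limitin_inv e) (simp_all add: o_def)
    moreover have "inv \<gamma> n \<otimes> ((?x n \<otimes> inv ?y n) \<otimes> \<delta> n) = x n \<otimes> inv y n" for n
    proof -
      have "\<gamma> n \<in> carrier G" "\<delta> n \<in> carrier G" "x n \<in> carrier G" "y n \<in> carrier G"
        using gd x y conv_seqsD by auto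
      then show ?thesis by (simp add: seq_mult_def m_assoc inv_mult_group)
    qed
    ultimately show ?thesis by simp
  qed
  have carr: "a \<in> carrier G" "b \<in> carrier G" "c \<in> carrier G" "d \<in> carrier G"
    using limitin_carrier rs(4,5) c d by auto
  define h where "h = (inv c \<otimes> (a \<otimes> d)) \<otimes> inv (inv c \<otimes> (b \<otimes> d))"
  have h: "h \<in> carrier G" "h \<noteq> \<one>"
    using carr rs(3) by (simp_all add: h_def mult_inv_eq_one_iff)
  have "\<one> \<in> T closure_of {g \<otimes> h \<otimes> inv g | g. g \<in> carrier G}"
    unfolding in_closure_of
  proof (intro conjI allI impI)
    fix N assume N: "\<one> \<in> N \<and> openin T N"
    then have N': "openin T N" "\<one> \<in> N" by auto
    obtain \<beta> p where "\<beta> \<in> conv_seqs T" "limitin T \<beta> p sequentially" "p \<otimes> h \<otimes> inv p \<in> N"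
      using squig_one_conjugate_small[OF sq order_refl x y rs(1) lim[OF rs(1,4)] rs(2) lim[OF rs(2,5)] N']
      unfolding h_def .
    with limitin_carrier show "\<exists>z. z \<in> {g \<otimes> h \<otimes> inv g | g. g \<in> carrier G} \<and> z \<in> N" by blast
  qed (simp add: topspace_eq)
  with h show ?thesis by (auto simp: distal_def)
qed

text \<open>After the first move the pair is still related at level 1, by a \<open>V\<close> whose
  members take values in \<open>C\<close>; limits of such members lie in \<open>C\<close>. The
  conjugates of \<open>h \<noteq> \<one>\<close> by elements of the compact set \<open>C\<close>
  form a closed set \<open>D\<close> missing \<open>\<one>\<close>, and its complement is a
  neighbourhood of \<open>\<one>\<close> that level 1 cannot satisfy.\<close>

lemma locally_compact_imp_not_unbalanced:
  assumes "locally_compact_space T"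
  shows "\<not> unbalanced (osuc (osuc 0)) G T"
proof
  assume "unbalanced (osuc (osuc 0)) G T"
  then obtain x y where x: "x \<in> UNIV \<rightarrow> carrier G" and y: "y \<in> UNIV \<rightarrow> carrier G"
    and sq: "squig (osuc (osuc 0)) (conv_seqs T) x y" and nE: "(x, y) \<notin> E_rel G T"
    by (auto simp: unbalanced_def carrier_conv_seq_group)
  obtain S C where SC: "openin T S" "\<one> \<in> S" "S \<subseteq> C" "closedin T C" "compactin T C"
    using locally_compact_one[OF assms(1)] .
  obtain \<gamma> \<delta> V where gd: "\<gamma> \<in> conv_seqs T" "\<delta> \<in> conv_seqs T"
    and V: "V \<subseteq> {\<gamma> \<in> conv_seqs T. range \<gamma> \<subseteq> S}"
    and sqV: "squig (osuc 0) V (seq_mult G \<gamma> x) (seq_mult G \<delta> y)"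
    and inC: "\<forall>n. seq_mult G \<gamma> x n \<otimes> inv seq_mult G \<delta> y n \<in> C"
    using squig_osuc_closed_nbhd[OF sq x y SC(1-4)] .
  let ?x = "seq_mult G \<gamma> x" and ?y = "seq_mult G \<delta> y"
  have Vc: "V \<subseteq> conv_seqs T" using V by blast
  have x': "?x \<in> UNIV \<rightarrow> carrier G" and y': "?y \<in> UNIV \<rightarrow> carrier G"
    using seq_mult_carrier gd x y by auto
  have nE': "(?x, ?y) \<notin> E_rel G T"
    using nE E_rel_seq_multD[OF gd x y] by blast
  obtain r s :: "nat \<Rightarrow> nat" and a b where rs: "strict_mono r" "strict_mono s" "a \<noteq> b"
    "limitin T (\<lambda>n. ?x (r n) \<otimes> inv ?y (r n)) a sequentially"
    "limitin T (\<lambda>n. ?x (s n) \<otimes> inv ?y (s n)) b sequentially"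
    using compact_cluster_points[OF SC(5) x' y' nE' inC[rule_format]] .
  have carr: "a \<in> carrier G" "b \<in> carrier G"
    using limitin_carrier rs(4,5) by auto
  define h where "h = a \<otimes> inv b"
  have h: "h \<in> carrier G" "h \<noteq> \<one>"
    using carr rs(3) by (simp_all add: h_def mult_inv_eq_one_iff)
  define D where "D = (\<lambda>p. p \<otimes> h \<otimes> inv p) ` C"
  have "continuous_map T T (\<lambda>p. p \<otimes> h \<otimes> inv p)"
    using h by (intro continuous_map_mult continuous_inv continuous_map_const_carrier) simp_all
  then have "closedin T D"
    unfolding D_def by (intro compactin_imp_closedin[OF Hausdorff] image_compactin[OF SC(5)])
  moreover have "\<one> \<notin> D"
  proof
    assume "\<one> \<in> D"
    then obtain p where "p \<in> C" and eq: "p \<otimes> h \<otimes> inv p = \<one>" by (auto simp: D_def)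
    then have p: "p \<in> carrier G" using SC(4) closedin_subset topspace_eq by blast
    then have "p \<otimes> h = p" using eq h mult_inv_eq_one_iff[of "p \<otimes> h" p] by simp
    with p h show False by simp
  qed
  ultimately have N: "openin T (topspace T - D)" "\<one> \<in> topspace T - D"
    by (simp_all add: topspace_eq closedin_def)
  obtain \<beta> p where \<beta>: "\<beta> \<in> V" "limitin T \<beta> p sequentially"
    and notD: "p \<otimes> (a \<otimes> inv b) \<otimes> inv p \<in> topspace T - D"
    using squig_one_conjugate_small[OF sqV Vc x' y' rs(1,4) rs(2,5) N] .
  have "\<beta> n \<in> C" for n using \<beta>(1) V SC(3) by blast
  then have "p \<in> C"
    by (intro limitin_closedin[OF \<beta>(2) SC(4)]) simp_all
  then have "p \<otimes> h \<otimes> inv p \<in> D" unfolding D_def by (rule imageI)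
  with notD show False by (simp add: h_def)
qed

end


section \<open>Wreath products\<close>

text \<open>As the first factor is discrete, a preimage is a union of open slices over single
  points.\<close>

lemma continuous_map_from_discrete_prod:
  assumes "\<And>l. l \<in> A \<Longrightarrow> continuous_map S T (\<lambda>c. f (l, c))"
  shows "continuous_map (prod_topology (discrete_topology A) S) T f"
  unfolding continuous_map_def
proof (intro conjI allI impI)
  show "f \<in> topspace (prod_topology (discrete_topology A) S) \<rightarrow> topspace T"
    using assms by (fastforce simp: continuous_map_def Pi_iff)
  fix U assume U: "openin T U"
  have "{p \<in> topspace (prod_topology (discrete_topology A) S). f p \<in> U} =
    (\<Union>l\<in>A. {l} \<times> {c \<in> topspace S. f (l, c) \<in> U})"
    by auto
  moreover have "openin (prod_topology (discrete_topology A) S) ({l} \<times> {c \<in> topspace S. f (l, c) \<in> U})"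
    if "l \<in> A" for l
    using openin_continuous_map_preimage[OF assms[OF that] U] that
    by (simp add: openin_prod_Times_iff)
  ultimately show "openin (prod_topology (discrete_topology A) S)
      {p \<in> topspace (prod_topology (discrete_topology A) S). f p \<in> U}"
    by (simp only:) blast
qed

locale wreath_group = completely_metrizable_group G T + L: group L
  for G :: "('a, 'b) monoid_scheme" (structure) and T :: "'a topology"
    and L :: "('l, 'm) monoid_scheme" +
  assumes countable_L: "countable (carrier L)"
begin

abbreviation "H \<equiv> wreath L G"
abbreviation "TH \<equiv> wreath_topology L T"

lemma carrier_wreath: "carrier H = carrier L \<times> (carrier L \<rightarrow>\<^sub>E carrier G)"
  by (simp add: wreath_def)

lemma one_wreath: "\<one>\<^bsub>H\<^esub> = (\<one>\<^bsub>L\<^esub>, \<lambda>k\<in>carrier L. \<one>)"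
  by (simp add: wreath_def)

lemma mult_wreath:
  "p \<otimes>\<^bsub>H\<^esub> q = (fst p \<otimes>\<^bsub>L\<^esub> fst q, \<lambda>k\<in>carrier L. snd p k \<otimes> snd q (inv\<^bsub>L\<^esub> fst p \<otimes>\<^bsub>L\<^esub> k))"
  by (simp add: wreath_def case_prod_unfold)

lemma snd_wreath_carrier: "\<lbrakk>p \<in> carrier H; k \<in> carrier L\<rbrakk> \<Longrightarrow> snd p k \<in> carrier G"
  by (auto simp: carrier_wreath)

lemma fst_wreath_carrier: "p \<in> carrier H \<Longrightarrow> fst p \<in> carrier L"
  by (auto simp: carrier_wreath)

lemma wreath_eqI:
  assumes "p \<in> carrier H" "q \<in> carrier H" "fst p = fst q" "\<And>k. k \<in> carrier L \<Longrightarrow> snd p k = snd q k"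
  shows "p = q"
proof (rule prod_eqI)
  show "snd p = snd q"
    using assms by (intro extensionalityI[of _ "carrier L"]) (auto simp: carrier_wreath PiE_iff)
qed (fact assms(3))

lemma mult_wreath_closed: "\<lbrakk>p \<in> carrier H; q \<in> carrier H\<rbrakk> \<Longrightarrow> p \<otimes>\<^bsub>H\<^esub> q \<in> carrier H"
  by (simp add: mult_wreath carrier_wreath mem_Times_iff PiE_iff)

text \<open>The inverse, named before \<open>H\<close> is known to be a group. Evaluating
  \<open>snd p\<close> at a translated place matches the shift that multiplication applies to its
  second factor.\<close>

definition winv :: "'l \<times> ('l \<Rightarrow> 'a) \<Rightarrow> 'l \<times> ('l \<Rightarrow> 'a)" where
  "winv p = (inv\<^bsub>L\<^esub> fst p, \<lambda>k\<in>carrier L. inv snd p (fst p \<otimes>\<^bsub>L\<^esub> k))"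

lemma winv_closed: "p \<in> carrier H \<Longrightarrow> winv p \<in> carrier H"
  by (simp add: winv_def carrier_wreath mem_Times_iff PiE_iff)

lemma winv_mult:
  assumes "p \<in> carrier H"
  shows "winv p \<otimes>\<^bsub>H\<^esub> p = \<one>\<^bsub>H\<^esub>"
  using fst_wreath_carrier[OF assms] snd_wreath_carrier[OF assms]
  by (simp add: winv_def mult_wreath one_wreath cong: restrict_cong)

lemma group_wreath: "group H"
proof (rule groupI)
  show one: "\<one>\<^bsub>H\<^esub> \<in> carrier H"
    by (simp add: one_wreath carrier_wreath)
  show "\<one>\<^bsub>H\<^esub> \<otimes>\<^bsub>H\<^esub> p = p" if "p \<in> carrier H" for p
    using that fst_wreath_carrier[OF that] snd_wreath_carrier[OF that]
    by (intro wreath_eqI mult_wreath_closed one) (simp_all add: mult_wreath one_wreath)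
  show "p \<otimes>\<^bsub>H\<^esub> q \<otimes>\<^bsub>H\<^esub> r = p \<otimes>\<^bsub>H\<^esub> (q \<otimes>\<^bsub>H\<^esub> r)"
    if "p \<in> carrier H" "q \<in> carrier H" "r \<in> carrier H" for p q r
    using that[THEN fst_wreath_carrier] that[THEN snd_wreath_carrier]
    by (intro wreath_eqI mult_wreath_closed that)
      (simp_all add: mult_wreath m_assoc L.m_assoc L.inv_mult_group)
  show "\<exists>q\<in>carrier H. q \<otimes>\<^bsub>H\<^esub> p = \<one>\<^bsub>H\<^esub>" if "p \<in> carrier H" for p
    using winv_closed[OF that] winv_mult[OF that] by blast
qed (rule mult_wreath_closed)

lemma inv_wreath: "p \<in> carrier H \<Longrightarrow> inv\<^bsub>H\<^esub> p = winv p"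
  using group.inv_equality[OF group_wreath winv_mult] winv_closed by blast

section \<open>The topology of the wreath product\<close>

lemma topspace_wreath: "topspace TH = carrier H"
  by (simp add: wreath_topology_def carrier_wreath topspace_eq)

lemma continuous_map_into_wreath:
  assumes "continuous_map X (discrete_topology (carrier L)) f"
    and "\<And>k. k \<in> carrier L \<Longrightarrow> continuous_map X T (\<lambda>z. g z k)"
  shows "continuous_map X TH (\<lambda>z. (f z, \<lambda>k\<in>carrier L. g z k))"
  unfolding wreath_topology_def continuous_map_paired continuous_map_componentwise
  using assms by auto

lemma continuous_map_fst_wreath: "continuous_map TH (discrete_topology (carrier L)) fst"
  unfolding wreath_topology_def by (rule continuous_map_fst)

text \<open>Evaluation at a coordinate that depends on a \<Lambda>-component is continuous because
  this component is locally constant. The shifts in products and inverses are of this kind.\<close>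

lemma continuous_map_snd_wreath:
  assumes "\<And>l. l \<in> carrier L \<Longrightarrow> e l \<in> carrier L"
    and f: "continuous_map X (discrete_topology (carrier L)) f" and g: "continuous_map X TH g"
  shows "continuous_map X T (\<lambda>z. snd (g z) (e (f z)))"
proof -
  have "continuous_map X (product_topology (\<lambda>_. T) (carrier L)) (\<lambda>z. snd (g z))"
    using continuous_map_compose[OF g[unfolded wreath_topology_def] continuous_map_snd]
    by (simp add: o_def)
  with f have 1: "continuous_map X (prod_topology (discrete_topology (carrier L)) (product_topology (\<lambda>_. T) (carrier L)))
      (\<lambda>z. (f z, snd (g z)))"
    by (rule continuous_map_pairedI)
  have 2: "continuous_map (prod_topology (discrete_topology (carrier L)) (product_topology (\<lambda>_. T) (carrier L))) T
      (\<lambda>p. snd p (e (fst p)))"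
  proof (rule continuous_map_from_discrete_prod)
    fix l assume "l \<in> carrier L"
    then show "continuous_map (product_topology (\<lambda>_. T) (carrier L)) T
        (\<lambda>c. snd (l, c) (e (fst (l, c))))"
      using continuous_map_product_projection[OF assms(1), of l "\<lambda>_. T"] by simp
  qed
  show ?thesis
    using continuous_map_compose[OF 1 2] by (simp add: o_def)
qed

lemma continuous_map_snd_wreath_const:
  "k \<in> carrier L \<Longrightarrow> continuous_map TH T (\<lambda>p. snd p k)"
  using continuous_map_snd_wreath[of "\<lambda>_. k" TH fst "\<lambda>p. p"] continuous_map_fst_wreath by simp

lemma topological_group_wreath: "topological_group H TH"
proof (rule topological_group.intro[OF group_wreath], unfold_locales)
  show "topspace TH = carrier H" by (rule topspace_wreath)
  let ?P = "prod_topology TH TH"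
  have f: "continuous_map ?P TH fst" and s: "continuous_map ?P TH snd"
    by (rule continuous_map_fst, rule continuous_map_snd)
  have ff: "continuous_map ?P (discrete_topology (carrier L)) (\<lambda>z. fst (fst z))"
    and fs: "continuous_map ?P (discrete_topology (carrier L)) (\<lambda>z. fst (snd z))"
    using continuous_map_compose[OF f continuous_map_fst_wreath]
      continuous_map_compose[OF s continuous_map_fst_wreath] by (simp_all add: o_def)
  have m: "continuous_map (prod_topology (discrete_topology (carrier L)) (discrete_topology (carrier L)))
      (discrete_topology (carrier L)) (\<lambda>p. fst p \<otimes>\<^bsub>L\<^esub> snd p)"
    by (simp flip: prod_topology_discrete_topology) auto
  have "continuous_map ?P TH (\<lambda>z. (fst (fst z) \<otimes>\<^bsub>L\<^esub> fst (snd z),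
    \<lambda>k\<in>carrier L. snd (fst z) k \<otimes> snd (snd z) (inv\<^bsub>L\<^esub> fst (fst z) \<otimes>\<^bsub>L\<^esub> k)))"
  proof (intro continuous_map_into_wreath continuous_map_mult)
    show "continuous_map ?P (discrete_topology (carrier L)) (\<lambda>z. fst (fst z) \<otimes>\<^bsub>L\<^esub> fst (snd z))"
      using continuous_map_compose[OF continuous_map_pairedI[OF ff fs] m] by (simp add: o_def)
    fix k assume k: "k \<in> carrier L"
    show "continuous_map ?P T (\<lambda>z. snd (fst z) k)"
      using continuous_map_snd_wreath[of "\<lambda>_. k", OF k ff f] .
    show "continuous_map ?P T (\<lambda>z. snd (snd z) (inv\<^bsub>L\<^esub> fst (fst z) \<otimes>\<^bsub>L\<^esub> k))"
      using continuous_map_snd_wreath[of "\<lambda>l. inv\<^bsub>L\<^esub> l \<otimes>\<^bsub>L\<^esub> k", OF _ ff s] k by simp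
  qed
  then show "continuous_map ?P TH (\<lambda>(x, y). x \<otimes>\<^bsub>H\<^esub> y)"
    by (simp add: mult_wreath case_prod_unfold)
  have "continuous_map TH TH winv"
    unfolding winv_def
  proof (intro continuous_map_into_wreath continuous_map_inv)
    have "continuous_map (discrete_topology (carrier L)) (discrete_topology (carrier L)) (\<lambda>l. inv\<^bsub>L\<^esub> l)"
      by auto
    from continuous_map_compose[OF continuous_map_fst_wreath this]
    show "continuous_map TH (discrete_topology (carrier L)) (\<lambda>p. inv\<^bsub>L\<^esub> fst p)"
      by (simp add: o_def)
    fix k assume "k \<in> carrier L"
    then show "continuous_map TH T (\<lambda>p. snd p (fst p \<otimes>\<^bsub>L\<^esub> k))"
      using continuous_map_snd_wreath[of "\<lambda>l. l \<otimes>\<^bsub>L\<^esub> k" TH fst "\<lambda>p. p"] continuous_map_fst_wreath by simp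
  qed
  then show "continuous_map TH TH (\<lambda>x. inv\<^bsub>H\<^esub> x)"
    by (rule continuous_map_eq) (simp add: topspace_wreath inv_wreath)
qed

sublocale H: completely_metrizable_group H TH
proof (rule completely_metrizable_group.intro[OF topological_group_wreath], unfold_locales)
  \<comment> \<open>The criterion for products asks for countably many nontrivial factors; this is
    where countability of \<Lambda> enters.\<close>
  have "countable {i \<in> carrier L. \<nexists>a. topspace T \<subseteq> {a}}"
    by (rule countable_subset[OF _ countable_L]) blast
  then show "completely_metrizable_space TH"
    using completely_metrizable unfolding wreath_topology_def
    by (simp add: completely_metrizable_space_prod_topology completely_metrizable_space_product_topology
        completely_metrizable_space_discrete_topology)
qed

text \<open>Equal \<Lambda>-components make the two shifts cancel. Convergence of such quotients can
  then be tested coordinate by coordinate in \<open>G\<close>.\<close>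

lemma mult_inv_wreath:
  assumes "p \<in> carrier H" "q \<in> carrier H" "fst p = fst q"
  shows "p \<otimes>\<^bsub>H\<^esub> inv\<^bsub>H\<^esub> q = (\<one>\<^bsub>L\<^esub>, \<lambda>k\<in>carrier L. snd p k \<otimes> inv snd q k)"
  using assms fst_wreath_carrier[OF assms(2)]
  by (simp add: inv_wreath winv_def mult_wreath L.m_assoc[symmetric] cong: restrict_cong)

section \<open>Transfer of the relations between \<open>G\<close> and the wreath product\<close>

definition bump :: "'l \<Rightarrow> 'a \<Rightarrow> 'l \<Rightarrow> 'a" where
  "bump l g = (\<lambda>k\<in>carrier L. if k = l then g else \<one>)"

lemma bump_carrier: "g \<in> carrier G \<Longrightarrow> bump l g \<in> carrier L \<rightarrow>\<^sub>E carrier G"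
  by (auto simp: bump_def)

lemma continuous_map_bump: "m \<in> carrier L \<Longrightarrow> continuous_map T TH (\<lambda>g. (m, bump l g))"
  unfolding bump_def
  by (rule continuous_map_into_wreath) (auto simp: topspace_eq)

text \<open>The elements with trivial \<Lambda>-component are a copy of a product space, in which a
  neighbourhood restricts finitely many coordinates. The freedom outside \<open>F\<close> is what
  gains one level.\<close>

lemma wreath_nbhd_one_finite:
  assumes "openin TH S" "\<one>\<^bsub>H\<^esub> \<in> S"
  obtains F where "finite F" "F \<subseteq> carrier L"
    "\<forall>c \<in> carrier L \<rightarrow>\<^sub>E carrier G. (\<forall>k\<in>F. c k = \<one>) \<longrightarrow> (\<one>\<^bsub>L\<^esub>, c) \<in> S"
proof -
  let ?PT = "product_topology (\<lambda>_. T) (carrier L)"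
  have "continuous_map ?PT TH (\<lambda>c. (\<one>\<^bsub>L\<^esub>, c))"
    unfolding wreath_topology_def continuous_map_paired by simp
  then have "openin ?PT {c \<in> topspace ?PT. (\<one>\<^bsub>L\<^esub>, c) \<in> S}"
    using assms(1) by (rule openin_continuous_map_preimage)
  moreover have "(\<lambda>k\<in>carrier L. \<one>) \<in> {c \<in> topspace ?PT. (\<one>\<^bsub>L\<^esub>, c) \<in> S}"
    using assms(2) by (simp add: one_wreath topspace_eq)
  ultimately obtain F where F: "finite F" "F \<subseteq> carrier L"
    "\<forall>c \<in> carrier L \<rightarrow>\<^sub>E topspace T. (\<forall>k\<in>F. c k = (\<lambda>k\<in>carrier L. \<one>) k) \<longrightarrow>
       c \<in> {c \<in> topspace ?PT. (\<one>\<^bsub>L\<^esub>, c) \<in> S}"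
    by (rule openin_product_topology_cofinite)
  have "(\<one>\<^bsub>L\<^esub>, c) \<in> S" if c: "c \<in> carrier L \<rightarrow>\<^sub>E carrier G" "\<forall>k\<in>F. c k = \<one>" for c
  proof -
    have "c k = (\<lambda>k\<in>carrier L. \<one>) k" if "k \<in> F" for k
      using c(2) F(2) that by auto
    then show ?thesis
      using F(3)[rule_format, of c] c(1) by (simp add: topspace_eq)
  qed
  then show thesis
    by (intro that[OF F(1,2)] ballI impI)
qed

text \<open>\<open>X\<close> and \<open>Y\<close> carry \<open>x\<close> and \<open>y\<close> at the
  identity coordinate. For a given \<open>W\<close>, the first move shifts that coordinate to some
  \<open>m\<close> outside \<open>F\<close>, where \<open>W\<close> contains a copy of all of
  \<open>c(G)\<close>. The level \<open>a\<close> relation of \<open>x\<close> and \<open>y\<close>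
  under \<open>c(G)\<close> then transfers to \<open>W\<close>.\<close>

lemma unbalanced_imp_wreath_unbalanced:
  assumes "unbalanced a G T" and inf: "infinite (carrier L)"
  shows "unbalanced (osuc a) H TH"
proof -
  obtain x y where x: "x \<in> UNIV \<rightarrow> carrier G" and y: "y \<in> UNIV \<rightarrow> carrier G"
    and sq: "squig a (conv_seqs T) x y" and nE: "(x, y) \<notin> E_rel G T"
    using assms(1) by (auto simp: unbalanced_def carrier_conv_seq_group)
  have xy: "x n \<in> carrier G" "y n \<in> carrier G" for n using x y by auto
  define X where "X = (\<lambda>n. (\<one>\<^bsub>L\<^esub>, bump \<one>\<^bsub>L\<^esub> (x n)))"
  define Y where "Y = (\<lambda>n. (\<one>\<^bsub>L\<^esub>, bump \<one>\<^bsub>L\<^esub> (y n)))"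
  have X: "X \<in> UNIV \<rightarrow> carrier H" and Y: "Y \<in> UNIV \<rightarrow> carrier H"
    using bump_carrier xy by (simp_all add: X_def Y_def carrier_wreath)
  have XY: "X n \<in> carrier H" "Y n \<in> carrier H" for n using X Y by auto
  have "(X, Y) \<notin> E_rel H TH"
  proof
    assume "(X, Y) \<in> E_rel H TH"
    then obtain l where l: "limitin TH (\<lambda>n. X n \<otimes>\<^bsub>H\<^esub> inv\<^bsub>H\<^esub> Y n) l sequentially"
      by (auto simp: E_rel_def)
    have "snd (X n \<otimes>\<^bsub>H\<^esub> inv\<^bsub>H\<^esub> Y n) \<one>\<^bsub>L\<^esub> = x n \<otimes> inv y n" for n
      using XY[of n] by (subst mult_inv_wreath) (simp_all add: X_def Y_def bump_def)
    then have "limitin T (\<lambda>n. x n \<otimes> inv y n) (snd l \<one>\<^bsub>L\<^esub>) sequentially"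
      using continuous_map_limit[OF continuous_map_snd_wreath_const[of "\<one>\<^bsub>L\<^esub>"] l] by (simp add: o_def)
    with nE x y show False by (auto simp: E_rel_def)
  qed
  moreover have "H.squig (osuc a) (conv_seqs TH) X Y"
    unfolding lrsquig_pos[OF osuc_neq_0]
  proof (intro allI impI)
    fix W U
    assume asm: "openin (conv_seq_topology TH) W \<and> \<one>\<^bsub>conv_seq_group H TH\<^esub> \<in> W \<and>
      openin (seq_topology TH) U \<and> (X \<in> U \<or> Y \<in> U)"
    then obtain S where S: "openin TH S" "\<one>\<^bsub>H\<^esub> \<in> S" "{\<gamma> \<in> conv_seqs TH. range \<gamma> \<subseteq> S} \<subseteq> W"
      using H.nbhd_one_contains[of W] by blast
    obtain F where F: "finite F" "F \<subseteq> carrier L"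
      "\<forall>c \<in> carrier L \<rightarrow>\<^sub>E carrier G. (\<forall>k\<in>F. c k = \<one>) \<longrightarrow> (\<one>\<^bsub>L\<^esub>, c) \<in> S"
      using wreath_nbhd_one_finite[OF S(1,2)] .
    obtain m where m: "m \<in> carrier L" "m \<notin> F"
      using inf F(1) by (meson finite_subset subsetI)
    obtain p where p: "p \<in> U" "p \<in> UNIV \<rightarrow> carrier H"
      using asm X Y by blast
    have pn: "p n \<in> carrier H" for n using p by auto
    have U: "openin (seq_topology TH) U" using asm by blast
    obtain N where N: "\<forall>z\<in>UNIV \<rightarrow> carrier H. (\<forall>n<N. z n = p n) \<longrightarrow> z \<in> U"
      using openin_seq_topology_initial[OF U p(1)] unfolding topspace_wreath .
    \<comment> \<open>The first \<open>N\<close> entries are frozen at \<open>p\<close>, so that the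
      images lie in \<open>U\<close>; \<open>\<Psi>\<close> is trivial at these indices to preserve
      equivariance.\<close>
    define \<Phi> where "\<Phi> = (\<lambda>z n. if n < N then p n else (m, bump m (z n)))"
    define \<Psi> where "\<Psi> = (\<lambda>\<gamma> n. if n < N then \<one>\<^bsub>H\<^esub> else (\<one>\<^bsub>L\<^esub>, bump m (\<gamma> n)))"
    have shift: "(m, \<lambda>k\<in>carrier L. \<one>) \<otimes>\<^bsub>H\<^esub> (\<one>\<^bsub>L\<^esub>, bump \<one>\<^bsub>L\<^esub> g) = (m, bump m g)"
      if "g \<in> carrier G" for g
    proof -
      have "inv\<^bsub>L\<^esub> m \<otimes>\<^bsub>L\<^esub> k = \<one>\<^bsub>L\<^esub> \<longleftrightarrow> k = m" if "k \<in> carrier L" for k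
        using m that by (metis L.inv_closed L.inv_equality L.inv_inv L.l_inv)
      then show ?thesis
        using m that by (auto simp: mult_wreath bump_def intro!: restrict_ext)
    qed
    have g: "(m, \<lambda>k\<in>carrier L. \<one>) \<in> carrier H"
      using m by (simp add: carrier_wreath)
    obtain \<gamma> where \<gamma>: "\<gamma> \<in> conv_seqs TH"
      "seq_mult H \<gamma> X = (\<lambda>n. if n < N then p n else (m, \<lambda>k\<in>carrier L. \<one>) \<otimes>\<^bsub>H\<^esub> X n)"
      using H.seq_in_orbit[OF X p(2) g] .
    obtain \<delta> where \<delta>: "\<delta> \<in> conv_seqs TH"
      "seq_mult H \<delta> Y = (\<lambda>n. if n < N then p n else (m, \<lambda>k\<in>carrier L. \<one>) \<otimes>\<^bsub>H\<^esub> Y n)"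
      using H.seq_in_orbit[OF Y p(2) g] .
    have \<gamma>x: "seq_mult H \<gamma> X = \<Phi> x" and \<delta>y: "seq_mult H \<delta> Y = \<Phi> y"
      unfolding \<gamma>(2) \<delta>(2) \<Phi>_def using shift xy by (auto simp: X_def Y_def)
    have "\<Phi> x \<in> U" "\<Phi> y \<in> U"
      using N H.seq_mult_carrier[OF \<gamma>(1) X] H.seq_mult_carrier[OF \<delta>(1) Y]
      unfolding \<gamma>x \<delta>y by (simp_all add: \<Phi>_def)
    have \<Psi>conv: "\<Psi> \<beta> \<in> conv_seqs TH" if "\<beta> \<in> conv_seqs T" for \<beta>
    proof -
      have b: "(\<lambda>n. (\<one>\<^bsub>L\<^esub>, bump m (\<beta> n))) \<in> conv_seqs TH"
        using that by (rule conv_seqs_continuous_image[OF continuous_map_bump[OF L.one_closed]])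
      then obtain l where "limitin TH (\<lambda>n. (\<one>\<^bsub>L\<^esub>, bump m (\<beta> n))) l sequentially"
        using H.conv_seqsD(2) by blast
      moreover have "\<forall>\<^sub>F n in sequentially. (\<one>\<^bsub>L\<^esub>, bump m (\<beta> n)) = \<Psi> \<beta> n"
        unfolding eventually_sequentially \<Psi>_def by (rule exI[of _ N]) simp
      ultimately have "limitin TH (\<Psi> \<beta>) l sequentially"
        by (simp add: limitin_transform_eventually)
      moreover have "\<Psi> \<beta> n \<in> topspace TH" for n
        using H.conv_seqsD(1)[OF b] by (simp add: \<Psi>_def topspace_wreath)
      ultimately show ?thesis unfolding conv_seqs_def by blast
    qed
    \<comment> \<open>No smallness of \<open>\<beta>\<close> enters: \<open>bump m\<close> is
      trivial on \<open>F\<close>, as \<open>m\<close> lies outside.\<close>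
    have \<Psi>W: "\<Psi> ` conv_seqs T \<subseteq> W"
    proof
      fix w assume "w \<in> \<Psi> ` conv_seqs T"
      then obtain \<beta> where \<beta>: "\<beta> \<in> conv_seqs T" "w = \<Psi> \<beta>" by blast
      have "(\<one>\<^bsub>L\<^esub>, bump m (\<beta> n)) \<in> S" for n
      proof -
        have "\<forall>k\<in>F. bump m (\<beta> n) k = \<one>"
          using m F(2) by (auto simp: bump_def)
        then show ?thesis
          using F(3) bump_carrier[OF conv_seqsD(1)[OF \<beta>(1)]] by blast
      qed
      then have "range w \<subseteq> S" using S(2) by (auto simp: \<beta> \<Psi>_def)
      then show "w \<in> W" using S(3) \<Psi>conv[OF \<beta>(1)] \<beta>(2) by blast
    qed
    have "H.squig b W (\<Phi> x) (\<Phi> y)" if "b \<le> a" for b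
    proof (rule lrsquig_equivariant[where B = "conv_seqs T" and V = "conv_seqs T" and \<Phi> = \<Phi> and \<Psi> = \<Psi>
          and x = x and y = y])
      show "continuous_map (seq_topology T) (seq_topology TH) \<Phi>"
        unfolding continuous_map_componentwise_UNIV
      proof
        fix n
        have "continuous_map (seq_topology T) TH (\<lambda>z. (m, bump m (z n)))"
          using continuous_map_compose[OF continuous_map_product_projection[of n UNIV "\<lambda>_. T"]
              continuous_map_bump[OF m(1)]]
          by (simp add: o_def)
        then show "continuous_map (seq_topology T) TH (\<lambda>z. \<Phi> z n)"
          using pn by (simp add: \<Phi>_def topspace_wreath)
      qed
      show "seq_mult G \<beta> z \<in> topspace (seq_topology T)"
        if "\<beta> \<in> conv_seqs T" "z \<in> topspace (seq_topology T)" for \<beta> z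
        using that seq_mult_carrier unfolding topspace_seq_eq by blast
      show "\<Phi> (seq_mult G \<beta> z) = seq_mult H (\<Psi> \<beta>) (\<Phi> z)"
        if "\<beta> \<in> conv_seqs T" "z \<in> topspace (seq_topology T)" for \<beta> z
      proof
        fix n
        have "\<beta> n \<in> carrier G" "z n \<in> carrier G"
          using that conv_seqsD unfolding topspace_seq_eq by auto
        then have "(\<one>\<^bsub>L\<^esub>, bump m (\<beta> n)) \<otimes>\<^bsub>H\<^esub> (m, bump m (z n)) = (m, bump m (\<beta> n \<otimes> z n))"
          using m by (auto simp: mult_wreath bump_def intro!: restrict_ext)
        then show "\<Phi> (seq_mult G \<beta> z) n = seq_mult H (\<Psi> \<beta>) (\<Phi> z) n"
          using pn by (simp add: \<Phi>_def \<Psi>_def seq_mult_def)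
      qed
      show "\<exists>W. openin (conv_seq_topology T) W \<and> \<one>\<^bsub>conv_seq_group G T\<^esub> \<in> W \<and> W \<subseteq> conv_seqs T \<and> \<Psi> ` W \<subseteq> W'"
        if W': "openin (conv_seq_topology TH) W'" "\<one>\<^bsub>conv_seq_group H TH\<^esub> \<in> W'" for W'
      proof -
        obtain S' where S': "openin TH S'" "\<one>\<^bsub>H\<^esub> \<in> S'" "{\<gamma> \<in> conv_seqs TH. range \<gamma> \<subseteq> S'} \<subseteq> W'"
          using H.nbhd_one_contains[OF W'] .
        \<comment> \<open>Unlike \<open>S\<close>, the set \<open>S'\<close> may restrict the
          coordinate \<open>m\<close>, so here the values of \<open>\<beta>\<close> have to be
          small.\<close>
        define R where "R = {g \<in> topspace T. (\<one>\<^bsub>L\<^esub>, bump m g) \<in> S'}"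
        have "openin T R" unfolding R_def
          by (rule openin_continuous_map_preimage[OF continuous_map_bump[OF L.one_closed] S'(1)])
        moreover have "\<one> \<in> R"
        proof -
          have "bump m \<one> = (\<lambda>k\<in>carrier L. \<one>)" by (auto simp: bump_def)
          then show ?thesis using S'(2) by (simp add: R_def topspace_eq one_wreath)
        qed
        ultimately obtain W where W: "openin (conv_seq_topology T) W" "\<one>\<^bsub>conv_seq_group G T\<^esub> \<in> W"
          "W \<subseteq> {\<gamma> \<in> conv_seqs T. range \<gamma> \<subseteq> R}"
          using nbhd_one_ex by blast
        have "\<Psi> \<beta> \<in> W'" if "\<beta> \<in> W" for \<beta>
        proof -
          have \<beta>: "\<beta> \<in> conv_seqs T" "range \<beta> \<subseteq> R" using that W(3) by auto
          then have "range (\<Psi> \<beta>) \<subseteq> S'"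
            using S'(2) by (auto simp: \<Psi>_def R_def)
          then show ?thesis using S'(3) \<Psi>conv[OF \<beta>(1)] by blast
        qed
        then show ?thesis using W by (intro exI[of _ W]) blast
      qed
      obtain W0 where "openin (conv_seq_topology T) W0" "\<one>\<^bsub>conv_seq_group G T\<^esub> \<in> W0"
        using nbhd_one_ex[OF openin_topspace] topspace_eq one_closed by metis
      then show "squig b (conv_seqs T) x y"
        using lrsquig_antimono[OF sq that] x y unfolding topspace_seq_eq by blast
      show "x \<in> topspace (seq_topology T)" "y \<in> topspace (seq_topology T)"
        unfolding topspace_seq_eq by (fact x, fact y)
    qed (simp_all add: \<Psi>W)
    then show "\<exists>gx\<in>conv_seqs TH. \<exists>gy\<in>conv_seqs TH. seq_mult H gx X \<in> U \<and> seq_mult H gy Y \<in> U \<and>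
        (\<forall>b<osuc a. H.squig b W (seq_mult H gx X) (seq_mult H gy Y))"
      using \<gamma>(1) \<delta>(1) \<open>\<Phi> x \<in> U\<close> \<open>\<Phi> y \<in> U\<close> \<gamma>x \<delta>y unfolding less_osuc_iff by metis
  qed
  ultimately show ?thesis
    unfolding unbalanced_def H.carrier_conv_seq_group using X Y by blast
qed

text \<open>The first move is spent on making the \<Lambda>-components of the two sequences agree.
  Their quotient then fails to converge at some coordinate \<open>k\<close>, and projecting to
  \<open>k\<close> carries the remaining level \<open>a\<close> relation to
  \<open>G\<close>.\<close>

lemma wreath_unbalanced_imp_unbalanced:
  assumes "unbalanced (osuc a) H TH"
  shows "unbalanced a G T"
proof -
  obtain X Y where X: "X \<in> UNIV \<rightarrow> carrier H" and Y: "Y \<in> UNIV \<rightarrow> carrier H"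
    and sq: "H.squig (osuc a) (conv_seqs TH) X Y" and nE: "(X, Y) \<notin> E_rel H TH"
    using assms unfolding unbalanced_def H.carrier_conv_seq_group by blast
  \<comment> \<open>Open and closed because \<Lambda> is discrete: open to yield a neighbourhood for
    the first move, closed so that quotients which level 0 puts into its closure lie in
    \<open>S\<close> itself.\<close>
  define S where "S = {\<one>\<^bsub>L\<^esub>} \<times> (carrier L \<rightarrow>\<^sub>E carrier G)"
  have S: "openin TH S" "closedin TH S" "\<one>\<^bsub>H\<^esub> \<in> S" "S \<subseteq> carrier H"
  proof -
    have top: "carrier L \<rightarrow>\<^sub>E carrier G = topspace (product_topology (\<lambda>_. T) (carrier L))"
      by (simp add: topspace_eq)
    show "openin TH S" unfolding S_def wreath_topology_def top openin_prod_Times_iff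
      by (intro disjI2 conjI openin_topspace) simp
    show "closedin TH S" unfolding S_def wreath_topology_def top closedin_prod_Times_iff
      by (intro disjI2 conjI closedin_topspace) simp
  qed (auto simp: S_def one_wreath carrier_wreath)
  define V0 where "V0 = {\<gamma> \<in> conv_seqs TH. range \<gamma> \<subseteq> S}"
  obtain V where V: "openin (conv_seq_topology TH) V" "\<one>\<^bsub>conv_seq_group H TH\<^esub> \<in> V" "V \<subseteq> V0"
    unfolding V0_def using H.nbhd_one_ex[OF S(1,3)] .
  have "X \<in> topspace (seq_topology TH) \<or> Y \<in> topspace (seq_topology TH)"
    unfolding H.topspace_seq_eq using X ..
  then obtain \<gamma> \<delta> where gd: "\<gamma> \<in> conv_seqs TH" "\<delta> \<in> conv_seqs TH"
    and "seq_mult H \<gamma> X \<in> topspace (seq_topology TH)" "seq_mult H \<delta> Y \<in> topspace (seq_topology TH)"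
    and sqV: "\<forall>b\<le>a. H.squig b V (seq_mult H \<gamma> X) (seq_mult H \<delta> Y)"
    by (rule lrsquig_osucD[OF sq V(1,2) openin_topspace])
  define X' where "X' = seq_mult H \<gamma> X"
  define Y' where "Y' = seq_mult H \<delta> Y"
  have X': "X' \<in> UNIV \<rightarrow> carrier H" and Y': "Y' \<in> UNIV \<rightarrow> carrier H"
    unfolding X'_def Y'_def by (rule H.seq_mult_carrier[OF gd(1) X], rule H.seq_mult_carrier[OF gd(2) Y])
  have XY: "X' n \<in> carrier H" "Y' n \<in> carrier H" for n using X' Y' by auto
  have fst_eq: "fst (X' n) = fst (Y' n)" for n
  proof -
    have "H.squig 0 V X' Y'" using sqV zero_le_omega1 unfolding X'_def Y'_def by blast
    then have "Y' n \<otimes>\<^bsub>H\<^esub> inv\<^bsub>H\<^esub> X' n \<in> TH closure_of S"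
      unfolding lrsquig_zero
      using H.in_closure_of_seq_multD[OF V(3)[unfolded V0_def] S(4) X'] by blast
    then have "Y' n \<otimes>\<^bsub>H\<^esub> inv\<^bsub>H\<^esub> X' n \<in> S"
      using S(2) by (simp add: closure_of_closedin)
    then have "fst (Y' n \<otimes>\<^bsub>H\<^esub> inv\<^bsub>H\<^esub> X' n) = \<one>\<^bsub>L\<^esub>" by (auto simp: S_def)
    then have "fst (Y' n) \<otimes>\<^bsub>L\<^esub> inv\<^bsub>L\<^esub> fst (X' n) = \<one>\<^bsub>L\<^esub>"
      using XY by (simp add: mult_wreath inv_wreath winv_def)
    then show ?thesis
      using XY[of n, THEN fst_wreath_carrier] by (metis L.inv_closed L.inv_equality L.inv_inv)
  qed
  \<comment> \<open>If all coordinates converged, so would the quotient of \<open>X'\<close> and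
    \<open>Y'\<close>, and invariance of \<open>E_rel\<close> would make \<open>X\<close> and
    \<open>Y\<close> equivalent.\<close>
  have "\<exists>k\<in>carrier L. (\<lambda>n. snd (X' n) k, \<lambda>n. snd (Y' n) k) \<notin> E_rel G T"
  proof (rule ccontr)
    assume "\<not> ?thesis"
    then have "\<forall>k\<in>carrier L. \<exists>l. limitin T (\<lambda>n. snd (X' n) k \<otimes> inv snd (Y' n) k) l sequentially"
      by (auto simp: E_rel_def)
    then obtain l where l: "\<And>k. k \<in> carrier L \<Longrightarrow>
        limitin T (\<lambda>n. snd (X' n) k \<otimes> inv snd (Y' n) k) (l k) sequentially"
      by metis
    have "limitin TH (\<lambda>n. X' n \<otimes>\<^bsub>H\<^esub> inv\<^bsub>H\<^esub> Y' n) (\<one>\<^bsub>L\<^esub>, \<lambda>k\<in>carrier L. l k) sequentially"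
      unfolding mult_inv_wreath[OF XY fst_eq] wreath_topology_def limitin_pairwise limitin_componentwise
      using l XY[THEN snd_wreath_carrier] by (simp add: o_def topspace_eq)
    then have "(X', Y') \<in> E_rel H TH"
      using X' Y' by (auto simp: E_rel_def)
    then show False
      using nE H.E_rel_seq_multD[OF gd X Y] unfolding X'_def Y'_def by blast
  qed
  then obtain k where k: "k \<in> carrier L" and nEk: "(\<lambda>n. snd (X' n) k, \<lambda>n. snd (Y' n) k) \<notin> E_rel G T"
    by blast
  define \<Phi> where "\<Phi> = (\<lambda>(Z :: nat \<Rightarrow> 'l \<times> ('l \<Rightarrow> 'a)) n. snd (Z n) k)"
  note cont_k = continuous_map_snd_wreath_const[OF k]
  have \<Phi>conv: "\<Phi> \<beta> \<in> conv_seqs T" if "\<beta> \<in> conv_seqs TH" for \<beta>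
    unfolding \<Phi>_def using that by (rule conv_seqs_continuous_image[OF cont_k])
  have "squig a (conv_seqs T) (\<Phi> X') (\<Phi> Y')"
  proof (rule lrsquig_equivariant[where B = V0 and V = V and \<Phi> = \<Phi> and \<Psi> = \<Phi> and x = X' and y = Y'])
    show "continuous_map (seq_topology TH) (seq_topology T) \<Phi>"
      unfolding continuous_map_componentwise_UNIV
    proof
      fix n
      show "continuous_map (seq_topology TH) T (\<lambda>Z. \<Phi> Z n)"
        using continuous_map_compose[OF continuous_map_product_projection[of n UNIV "\<lambda>_. TH"] cont_k]
        by (simp add: o_def \<Phi>_def)
    qed
    show "seq_mult H \<beta> Z \<in> topspace (seq_topology TH)"
      if "\<beta> \<in> V0" "Z \<in> topspace (seq_topology TH)" for \<beta> Z
      using that H.seq_mult_carrier unfolding H.topspace_seq_eq V0_def by blast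
    show "\<Phi> (seq_mult H \<beta> Z) = seq_mult G (\<Phi> \<beta>) (\<Phi> Z)"
      if "\<beta> \<in> V0" "Z \<in> topspace (seq_topology TH)" for \<beta> Z
    proof
      fix n
      have "\<beta> n \<in> S" using that(1) by (auto simp: V0_def)
      then have "fst (\<beta> n) = \<one>\<^bsub>L\<^esub>" by (auto simp: S_def)
      then show "\<Phi> (seq_mult H \<beta> Z) n = seq_mult G (\<Phi> \<beta>) (\<Phi> Z) n"
        using k by (simp add: \<Phi>_def seq_mult_def mult_wreath)
    qed
    show "\<exists>W. openin (conv_seq_topology TH) W \<and> \<one>\<^bsub>conv_seq_group H TH\<^esub> \<in> W \<and> W \<subseteq> V0 \<and> \<Phi> ` W \<subseteq> W'"
      if W': "openin (conv_seq_topology T) W'" "\<one>\<^bsub>conv_seq_group G T\<^esub> \<in> W'" for W'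
    proof -
      obtain S' where S': "openin T S'" "\<one> \<in> S'" "{\<gamma> \<in> conv_seqs T. range \<gamma> \<subseteq> S'} \<subseteq> W'"
        using nbhd_one_contains[OF W'] .
      \<comment> \<open>Intersecting with \<open>S\<close> keeps the \<Lambda>-components trivial,
        hence \<open>W\<close> inside \<open>V0\<close>, where the projection is
        equivariant.\<close>
      define R where "R = S \<inter> {h \<in> topspace TH. snd h k \<in> S'}"
      have "openin TH R" unfolding R_def
        by (intro openin_Int S(1) openin_continuous_map_preimage[OF cont_k S'(1)])
      moreover have "\<one>\<^bsub>H\<^esub> \<in> R"
        using S(3,4) S'(2) k by (auto simp: R_def topspace_wreath one_wreath)
      ultimately obtain W where W: "openin (conv_seq_topology TH) W" "\<one>\<^bsub>conv_seq_group H TH\<^esub> \<in> W"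
        "W \<subseteq> {\<gamma> \<in> conv_seqs TH. range \<gamma> \<subseteq> R}"
        using H.nbhd_one_ex by blast
      have "W \<subseteq> V0" using W(3) by (auto simp: V0_def R_def)
      moreover have "\<Phi> \<beta> \<in> W'" if "\<beta> \<in> W" for \<beta>
      proof -
        have \<beta>: "\<beta> \<in> conv_seqs TH" "range \<beta> \<subseteq> R" using that W(3) by auto
        then have "range (\<Phi> \<beta>) \<subseteq> S'" by (auto simp: \<Phi>_def R_def)
        then show ?thesis using S'(3) \<Phi>conv[OF \<beta>(1)] by blast
      qed
      ultimately show ?thesis using W(1,2) by (intro exI[of _ W]) blast
    qed
    show "H.squig a V X' Y'" using sqV unfolding X'_def Y'_def by blast
    show "X' \<in> topspace (seq_topology TH)" "Y' \<in> topspace (seq_topology TH)"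
      unfolding H.topspace_seq_eq by (fact X', fact Y')
    show "V \<subseteq> V0" by (fact V(3))
    show "\<Phi> ` V \<subseteq> conv_seqs T" using V(3) \<Phi>conv by (auto simp: V0_def)
  qed
  moreover have "\<Phi> X' \<in> UNIV \<rightarrow> carrier G" "\<Phi> Y' \<in> UNIV \<rightarrow> carrier G"
    using XY[THEN snd_wreath_carrier] k by (simp_all add: \<Phi>_def)
  ultimately show ?thesis
    using nEk unfolding unbalanced_def carrier_conv_seq_group \<Phi>_def by blast
qed

end

theorem theorem1p5:
  fixes G :: "('a, 'b) monoid_scheme" and T :: "'a topology"
  assumes "polish_group G T"
  shows "(\<not> distal G T \<longrightarrow> unbalanced (osuc 0) G T) \<and>
         (locally_compact_space T \<longrightarrow> (\<not> distal G T \<longleftrightarrow> unbalanced (osuc 0) G T)) \<and>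
         (locally_compact_space T \<longrightarrow> \<not> unbalanced (osuc (osuc 0)) G T) \<and>
         (\<forall>(L :: ('l, 'm) monoid_scheme) \<alpha>.
            group L \<and> countable (carrier L) \<and> infinite (carrier L) \<longrightarrow>
            (unbalanced \<alpha> G T \<longleftrightarrow> unbalanced (osuc \<alpha>) (wreath L G) (wreath_topology L T)))"
proof -
  interpret polish_group G T by fact
  interpret completely_metrizable_group G T
    by unfold_locales (rule completely_metrizable)
  have "unbalanced \<alpha> G T \<longleftrightarrow> unbalanced (osuc \<alpha>) (wreath L G) (wreath_topology L T)"
    if L: "group L" "countable (carrier L)" "infinite (carrier L)"
    for L :: "('l, 'm) monoid_scheme" and \<alpha>
  proof -
    interpret wreath_group G T L
      using completely_metrizable_group_axioms L(1,2)
      by (simp add: wreath_group_def wreath_group_axioms_def)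
    show ?thesis
      using unbalanced_imp_wreath_unbalanced wreath_unbalanced_imp_unbalanced L(3) by blast
  qed
  then show ?thesis
    using not_distal_imp_unbalanced unbalanced_one_imp_not_distal locally_compact_imp_not_unbalanced
    by blast
qed

end
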